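(* Let $M$ be the thrice-punctured disc. The action of each of the Dehn twists $t_c$, $t_d$ and $t_e$ induced on the integer plane $\mathbb{Z}^2$ of Dynnikov coordinates $(a,b)$ is piecewise linear and area preserving. The linearity regions (domain) and their images (codomain) are the following. (1) For $t_c$, the linearity regions are $A=\{a\ge 0,\ b\le a\}$, $B=\{0\le a\le b\le 2a\}$, $C=\{2a\le b,\ b\ge 0\}$, $D=\{a\le 0,\ b\le 0\}$, with respective images $A'=\{a\le 0,\ b\le -a\}$, $B'=\{a\ge 0,\ b\le 0\}$, $C'=\{b\ge 0,\ b\ge -2a\}$, $D'=\{0\le -a\le b\le -2a\}$. (2) For $t_d$, the linearity regions and their images are the opposites $-A,-B,-C,-D$ and $-A',-B',-C',-D'$ of those for $t_c$; that is, the linearity regions are $\{a\le 0,\ a\le b\}$, $\{2a\le b\le a\le 0\}$, $\{b\le 2a,\ b\le 0\}$, $\{a\ge 0,\ b\ge 0\}$. (3) For $t_e$, the linearity regions are $\{a\ge 0,\ b\ge 0\}$, $\{a\ge 0,\ b\le 0\}$, $\{a\le 0,\ b\le -\tfrac a2\}$, $\{0\le -\tfrac a2\le b\le -\tfrac{2a}{3}\}$, $\{0\le -\tfrac{2a}{3}\le b\le -a\}$, $\{0\le -a\le b\}$, with respective images $\{\tfrac{3b}{2}\le a\le b\le 0\}$, $\{2b\le a\le \tfrac{3b}{2}\le 0\}$, $\{a\le 0,\ \tfrac a2\le b\}$, $\{a\ge 0,\ b\ge 0\}$, $\{a\ge 0,\ b\le 0\}$, $\{b\le a\le 0\}$. The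 linearity regions are bounded by fans of rays, which have similar shape in the domain and the codomain.
   Context: $M$ is a disc with three punctures $1,2,3$ placed from left to right on its horizontal diameter. $\mathrm{Mod}(M)$ is the group of isotopy classes of orientation preserving diffeomorphisms of $M$, where diffeomorphisms and isotopies are the identity on $\partial M$. A simple closed curve in $M$ is essential if it bounds neither a disc nor a once-punctured disc, nor an annulus together with $\partial M$. $S$ denotes the set of isotopy classes of nonempty finite unions of pairwise disjoint essential simple closed curves in $M$. Dynnikov coordinates. Let $\alpha_1$ (respectively $\alpha_2$) be the vertical arc from puncture $2$ up (respectively down) to $\partial M$; let $\beta_1$ (respectively $\beta_2$) be the vertical arc with both endpoints on $\partial M$ separating puncture $1$ from punctures $2,3$ (respectively punctures $1,2$ from puncture $3$). For $l\in S$ write $\alpha_i,\beta_i$ also for the minimal intersection number of $l$ with the corresponding arc. The Dynnikov coordinates of $l$ are $\rho(l)=(a,b)$ with $a=\frac{\alpha_2-\alpha_1}{2}$, $b=\frac{\beta_1-\beta_2}{2}$, and $\rho:S\to\mathbb{Z}^2\setminus\{0\}$ is a bijection. A mapping class $\phi$ acts on the Dynnikov coordinate plane by $(a,b)\mapsto\rho(\phi(\rho^{-1}(a,b)))$. Curves and twists. $c$ is the curve enclosing punctures $1,2$ and $d$ the curve enclosing punctures $2,3$ (boundaries of neighbourhoods of the straight segments joining these punctures), and $e$ is the curve enclosing punctures $1,3$ that passes above puncture $2$; thus $\rho(c)=(0,1)$, $\rho(d)=(0,-1)$, $\rho(e)=(-1,0)$. $t_c=\sigma_1^2$ and $t_d=\sigma_2^2$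 are the Dehn twists about $c$ and $d$, where $\sigma_1,\sigma_2$ are the Artin braid generators (half twists exchanging punctures $i$ and $i+1$), with direction fixed by the update rules: if $\rho(l)=(a,b)$ then $\rho(\sigma_1(l))=(a+b-\max\{0,a,b\},\ \max\{b,0\}-a)$ and $\rho(\sigma_2(l))=(\max\{a+\max\{0,b\},b\},\ b-(a+\max\{0,b\}))$. The Dehn twist $t_e$ about $e$ acts as $(t_ct_d)^{-1}$, where $t_ct_d$ means first $t_d$, then $t_c$. *)

theory Defs
  imports "HOL-Analysis.Analysis"
begin

section \<open>The thrice-punctured disc and its mapping class group\<close>

text \<open>The disc has centre 0 and radius 2 in the complex plane; punctures 1, 2, 3 are the
  points -1, 0, 1, which are removed.\<close>

definition disc3 :: "complex set" where
  "disc3 = cball 0 2 - {-1, 0, 1}"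

abbreviation bd_disc3 :: "complex set" where
  "bd_disc3 \<equiv> sphere 0 2"

text \<open>\<open>Ck_on k f U\<close> is meant for open \<open>U\<close>: all iterated directional derivatives of \<open>f\<close> up to
  order \<open>k\<close> exist and are continuous on \<open>U\<close> (real differentiability, not holomorphy).
  On other sets, \<open>smooth_on\<close> asks for a smooth extension to an open neighbourhood.\<close>

primrec Ck_on :: "nat \<Rightarrow> (complex \<Rightarrow> complex) \<Rightarrow> complex set \<Rightarrow> bool" where
  "Ck_on 0 f U \<longleftrightarrow> continuous_on U f"
| "Ck_on (Suc k) f U \<longleftrightarrow>
     (\<exists>f'. (\<forall>x\<in>U. (f has_derivative f' x) (at x)) \<and> (\<forall>v. Ck_on k (\<lambda>x. f' x v) U))"

definition smooth_on :: "complex set \<Rightarrow> (complex \<Rightarrow> complex) \<Rightarrow> bool" where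
  "smooth_on A f \<longleftrightarrow>
     (\<exists>U g. open U \<and> A \<subseteq> U \<and> (\<forall>k. Ck_on k g U) \<and> (\<forall>x\<in>A. g x = f x))"

text \<open>\<open>Im (cnj (f' 1) * f' \<i>)\<close> is the Jacobian determinant of \<open>f'\<close>.\<close>

definition orientation_preserving :: "(complex \<Rightarrow> complex) \<Rightarrow> bool" where
  "orientation_preserving f \<longleftrightarrow>
     (\<forall>z\<in>interior disc3. \<forall>f'. (f has_derivative f') (at z) \<longrightarrow> 0 < Im (cnj (f' 1) * f' \<i>))"

text \<open>Only the values on \<open>disc3\<close> matter; the values elsewhere are arbitrary.\<close>

definition Diff :: "(complex \<Rightarrow> complex) set" where
  "Diff = {f. bij_betw f disc3 disc3 \<and> smooth_on disc3 f \<and> smooth_on disc3 (inv_into disc3 f) \<and>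
              (\<forall>z\<in>bd_disc3. f z = z) \<and> orientation_preserving f}"

definition diff_isotopy :: "((complex \<Rightarrow> complex) \<times> (complex \<Rightarrow> complex)) set" where
  "diff_isotopy = {(f, g). f \<in> Diff \<and> g \<in> Diff \<and>
                     homotopic_with_canon (\<lambda>h. h \<in> Diff) disc3 disc3 f g}"

type_synonym mapping_class = "(complex \<Rightarrow> complex) set"

definition Mod :: "mapping_class set" where
  "Mod = Diff // diff_isotopy"

text \<open>Functional order: \<open>mcg_mult \<phi> \<psi>\<close> is first \<open>\<psi>\<close>, then \<open>\<phi>\<close>.\<close>

definition mcg_mult :: "mapping_class \<Rightarrow> mapping_class \<Rightarrow> mapping_class" where
  "mcg_mult \<phi> \<psi> = (\<Union>f\<in>\<phi>. \<Union>g\<in>\<psi>. diff_isotopy `` {f \<circ> g})"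

section \<open>Curves\<close>

definition simple_closed_curve :: "complex set \<Rightarrow> bool" where
  "simple_closed_curve c \<longleftrightarrow> c \<subseteq> interior disc3 \<and>
     (\<exists>\<gamma>. simple_path \<gamma> \<and> pathfinish \<gamma> = pathstart \<gamma> \<and> path_image \<gamma> = c)"

definition bounds_disc :: "complex set \<Rightarrow> bool" where
  "bounds_disc c \<longleftrightarrow> (\<exists>D\<subseteq>disc3. \<exists>h k.
     homeomorphism (cball (0::complex) 1) D h k \<and> h ` sphere 0 1 = c)"

text \<open>Closedness of \<open>D\<close> in \<open>disc3\<close> forces the missing point to be a puncture; without it
  a half-open collar of any curve would qualify.\<close>

definition bounds_punctured_disc :: "complex set \<Rightarrow> bool" where
  "bounds_punctured_disc c \<longleftrightarrow> (\<exists>D\<subseteq>disc3. closedin (top_of_set disc3) D \<and> (\<exists>h k.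
     homeomorphism (cball (0::complex) 1 - {0}) D h k \<and> h ` sphere 0 1 = c))"

definition bounds_annulus_with_boundary :: "complex set \<Rightarrow> bool" where
  "bounds_annulus_with_boundary c \<longleftrightarrow> (\<exists>D\<subseteq>disc3. \<exists>h k.
     homeomorphism (cball (0::complex) 2 - ball 0 1) D h k \<and>
     h ` sphere 0 1 = c \<and> h ` sphere 0 2 = bd_disc3)"

definition essential :: "complex set \<Rightarrow> bool" where
  "essential c \<longleftrightarrow>
     \<not> bounds_disc c \<and> \<not> bounds_punctured_disc c \<and> \<not> bounds_annulus_with_boundary c"

definition multicurves :: "complex set set" where
  "multicurves = {\<Union>C | C. finite C \<and> C \<noteq> {} \<and> pairwise disjnt C \<and>
                         (\<forall>c\<in>C. simple_closed_curve c \<and> essential c)}"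

text \<open>Isotopy through embeddings; a multicurve is compact, so a continuous injection of it is
  an embedding.\<close>

definition curve_isotopy :: "(complex set \<times> complex set) set" where
  "curve_isotopy = {(l, l'). l \<in> multicurves \<and> l' \<in> multicurves \<and>
     (\<exists>g. homotopic_with_canon (\<lambda>h. inj_on h l) l (interior disc3) id g \<and> g ` l = l')}"

type_synonym curve_system = "complex set set"

definition curve_systems :: "curve_system set" where
  "curve_systems = multicurves // curve_isotopy"

definition act :: "mapping_class \<Rightarrow> curve_system \<Rightarrow> curve_system" where
  "act \<phi> L = (\<Union>f\<in>\<phi>. \<Union>l\<in>L. curve_isotopy `` {f ` l})"

section \<open>Dynnikov coordinates\<close>

definition arc_alpha1 :: "complex set" where
  "arc_alpha1 = {z. Re z = 0 \<and> 0 < Im z \<and> Im z \<le> 2}"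

definition arc_alpha2 :: "complex set" where
  "arc_alpha2 = {z. Re z = 0 \<and> -2 \<le> Im z \<and> Im z < 0}"

definition arc_beta1 :: "complex set" where
  "arc_beta1 = {z \<in> disc3. Re z = -1/2}"

definition arc_beta2 :: "complex set" where
  "arc_beta2 = {z \<in> disc3. Re z = 1/2}"

definition intersection_number :: "curve_system \<Rightarrow> complex set \<Rightarrow> nat" where
  "intersection_number L \<alpha> = (LEAST n. \<exists>l\<in>L. finite (l \<inter> \<alpha>) \<and> card (l \<inter> \<alpha>) = n)"

definition dynnikov :: "curve_system \<Rightarrow> real^2" where
  "dynnikov L = vector
     [(real (intersection_number L arc_alpha2) - real (intersection_number L arc_alpha1)) / 2,
      (real (intersection_number L arc_beta1) - real (intersection_number L arc_beta2)) / 2]"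

definition int_plane :: "(real^2) set" where
  "int_plane = {x. x$1 \<in> \<int> \<and> x$2 \<in> \<int>}"

text \<open>The origin is not the coordinate vector of a curve system; by convention it is fixed.\<close>

definition dynnikov_action :: "mapping_class \<Rightarrow> real^2 \<Rightarrow> real^2" where
  "dynnikov_action \<phi> x =
     (if x = 0 then 0 else dynnikov (act \<phi> (inv_into curve_systems dynnikov x)))"

section \<open>Half twists and Dehn twists\<close>

text \<open>\<open>nbhd_curve A\<close> is the class of the boundary of the closed 1/4-neighbourhood of the arc
  \<open>A\<close>; for \<open>curve_e\<close> the arc is the upper half of the unit circle, from puncture 1 to
  puncture 3 above puncture 2.\<close>

definition nbhd_curve :: "complex set \<Rightarrow> curve_system" where
  "nbhd_curve A = curve_isotopy `` {frontier {z. infdist z A \<le> 1/4}}"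

definition curve_c :: curve_system where
  "curve_c = nbhd_curve (closed_segment (-1) 0)"

definition curve_d :: curve_system where
  "curve_d = nbhd_curve (closed_segment 0 1)"

definition curve_e :: curve_system where
  "curve_e = nbhd_curve {z. cmod z = 1 \<and> 0 \<le> Im z}"

text \<open>A half twist rotates the disc of radius 1/2 around the midpoint \<open>m\<close> of two adjacent
  punctures (which lie on its boundary) by the angle \<open>\<pm>\<pi>\<close> and is the identity outside the
  disc of radius 1 around \<open>m\<close>, which misses the third puncture. The sense \<open>s\<close> of rotation is
  left open here. Smoothness of the profile \<open>\<kappa>\<close> need not be required, because elements of
  a mapping class are diffeomorphisms.\<close>

definition half_twist :: "complex \<Rightarrow> mapping_class \<Rightarrow> bool" where
  "half_twist m \<phi> \<longleftrightarrow> \<phi> \<in> Mod \<and>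
     (\<exists>s\<in>{1, -1}. \<exists>(\<kappa> :: real \<Rightarrow> real). continuous_on UNIV \<kappa> \<and>
        (\<forall>r\<le>1/2. \<kappa> r = 1) \<and> (\<forall>r\<ge>1. \<kappa> r = 0) \<and>
        (\<lambda>z. m + (z - m) * cis (s * pi * \<kappa> (cmod (z - m)))) \<in> \<phi>)"

text \<open>A Dehn twist about the class \<open>L\<close> of a simple closed curve: in an embedded annulus \<open>j\<close>
  whose core lies in \<open>L\<close>, the circle of radius \<open>r\<close> is rotated by an angle going
  continuously from \<open>\<pm>2\<pi>\<close> to 0; outside the annulus nothing moves. Both senses \<open>s\<close> are
  admitted, so the orientation of \<open>j\<close> is irrelevant.\<close>

definition dehn_twist :: "curve_system \<Rightarrow> mapping_class \<Rightarrow> bool" where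
  "dehn_twist L \<phi> \<longleftrightarrow> \<phi> \<in> Mod \<and>
     (\<exists>f\<in>\<phi>. \<exists>s\<in>{1, -1}. \<exists>(j :: complex \<Rightarrow> complex) (\<kappa> :: real \<Rightarrow> real).
        let N = cball 0 2 - ball 0 1 in
        continuous_on N j \<and> inj_on j N \<and> j ` N \<subseteq> interior disc3 \<and>
        j ` sphere 0 (3/2) \<in> L \<and>
        continuous_on {1..2} \<kappa> \<and> \<kappa> 1 = 1 \<and> \<kappa> 2 = 0 \<and>
        (\<forall>z\<in>N. f (j z) = j (z * cis (s * (2 * pi) * \<kappa> (cmod z)))) \<and>
        (\<forall>z\<in>disc3 - j ` N. f z = z))"

section \<open>Piecewise linear maps of the plane\<close>

definition sector :: "real^2 \<Rightarrow> real^2 \<Rightarrow> (real^2) set" where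
  "sector u v = {s *\<^sub>R u + t *\<^sub>R v | s t. 0 \<le> s \<and> 0 \<le> t}"

text \<open>The sectors between consecutive rays of a counterclockwise cyclic list of rays, making
  exactly one turn (the sectors fill the plane and do not overlap).\<close>

definition fan_regions :: "(real^2) set set \<Rightarrow> bool" where
  "fan_regions \<R> \<longleftrightarrow>
     (\<exists>vs. (let n = length vs; v = (\<lambda>i. vs ! (i mod n)) in
          (\<forall>i<n. 0 < v i $ 1 * v (Suc i) $ 2 - v i $ 2 * v (Suc i) $ 1) \<and>
          \<R> = {sector (v i) (v (Suc i)) | i. i < n})) \<and>
     \<Union>\<R> = UNIV \<and> pairwise (\<lambda>R R'. interior R \<inter> interior R' = {}) \<R>"

definition agrees_with_linear_on :: "(real^2 \<Rightarrow> real^2) \<Rightarrow> (real^2) set \<Rightarrow> bool" where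
  "agrees_with_linear_on F R \<longleftrightarrow> (\<exists>L. linear L \<and> (\<forall>x\<in>R. F x = L x))"

text \<open>The last conjunct says that the decomposition is not finer than necessary.\<close>

definition linearity_regions :: "(real^2 \<Rightarrow> real^2) \<Rightarrow> (real^2) set set \<Rightarrow> bool" where
  "linearity_regions F \<R> \<longleftrightarrow> fan_regions \<R> \<and>
     (\<forall>R\<in>\<R>. agrees_with_linear_on F R) \<and>
     (\<forall>R\<in>\<R>. \<forall>R'\<in>\<R>. R \<noteq> R' \<longrightarrow> \<not> agrees_with_linear_on F (R \<union> R'))"

definition area_preserving :: "(real^2 \<Rightarrow> real^2) \<Rightarrow> bool" where
  "area_preserving F \<longleftrightarrow> (\<forall>X\<in>sets lebesgue. F ` X \<in> sets lebesgue \<and>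
                            emeasure lebesgue (F ` X) = emeasure lebesgue X)"

text \<open>Two fans have similar shape if an isometry fixing the origin carries one to the other.\<close>

definition similar_fans :: "(real^2) set set \<Rightarrow> (real^2) set set \<Rightarrow> bool" where
  "similar_fans \<R> \<R>' \<longleftrightarrow> fan_regions \<R> \<and> fan_regions \<R>' \<and>
     (\<exists>Q. orthogonal_transformation Q \<and> \<R>' = (\<lambda>R. Q ` R) ` \<R>)"

text \<open>\<open>T\<close> is a map of the integer plane. It is piecewise linear and area preserving in that it
  is the restriction of such a map \<open>F\<close> of the real plane. The list consists of the linearity
  regions of \<open>F\<close>, each paired with its image.\<close>

definition piecewise_linear_area_preserving ::
    "(real^2 \<Rightarrow> real^2) \<Rightarrow> ((real^2) set \<times> (real^2) set) list \<Rightarrow> bool" where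
  "piecewise_linear_area_preserving T ps \<longleftrightarrow>
     (\<exists>F. (\<forall>x\<in>int_plane. T x = F x) \<and> area_preserving F \<and>
        linearity_regions F (fst ` set ps) \<and>
        (\<forall>(R, R')\<in>set ps. F ` R = R' \<and> T ` (R \<inter> int_plane) = R' \<inter> int_plane)) \<and>
     similar_fans (fst ` set ps) (snd ` set ps)"

end

theory Submission
  imports Defs
begin

text \<open>Diffeomorphisms act on isotopy classes of curve systems, and products of mapping classes act
  by composition. Hence \<open>t\<^sub>c\<close> and \<open>t\<^sub>d\<close> act on Dynnikov coordinates by the squares of the update
  rules of \<open>\<sigma>\<^sub>1\<close> and \<open>\<sigma>\<^sub>2\<close>, and \<open>t\<^sub>e\<close>, being determined by its values on the images of \<open>t\<^sub>c t\<^sub>d\<close>, acts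
  by the inverse of their composition. On each sector between consecutive rays these maps agree with
  an integer matrix of determinant 1; a bijection pieced together from finitely many such matrices on
  the sectors of a fan preserves area because the rays are null sets. The matrices are
  pairwise distinct, so no two sectors merge, and a reflection in a coordinate axis carries the fan of
  the domain to that of the codomain.\<close>

section \<open>Sectors and piecewise linear maps\<close>

text \<open>The signed area spanned by \<open>u\<close> and \<open>v\<close>, which is the
  expression required to be positive in \<open>fan_regions\<close>: the turn from \<open>u\<close>
  to \<open>v\<close> is counterclockwise and less than a half turn.\<close>

definition det2 :: "real^2 \<Rightarrow> real^2 \<Rightarrow> real" where
  "det2 u v = u$1 * v$2 - u$2 * v$1"

definition lin2 :: "real \<Rightarrow> real \<Rightarrow> real \<Rightarrow> real \<Rightarrow> real^2 \<Rightarrow> real^2" where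
  "lin2 p q r s x = vector [p * x$1 + q * x$2, r * x$1 + s * x$2]"

lemma vec2_eq_iff: "(x::real^2) = y \<longleftrightarrow> x$1 = y$1 \<and> x$2 = y$2"
  by (simp add: vec_eq_iff forall_2)

lemma lin2_nth [simp]:
  "lin2 p q r s x $ 1 = p * x$1 + q * x$2" "lin2 p q r s x $ 2 = r * x$1 + s * x$2"
  by (simp_all add: lin2_def)

lemma linear_lin2: "linear (lin2 p q r s)"
  by (rule linearI) (simp_all add: vec2_eq_iff algebra_simps)

lemma det_matrix_lin2: "det (matrix (lin2 p q r s)) = p * s - q * r"
  by (simp add: det_2 matrix_def axis_def)

text \<open>At determinant 1 the inverse is the adjugate. Its entries are integers when those of the
  matrix are, so lattice points come from lattice points.\<close>

lemma lin2_inverse: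
  assumes "p * s - q * r = 1"
  shows "lin2 s (-q) (-r) p (lin2 p q r s x) = x"
proof -
  have "s * (p * x$1 + q * x$2) - q * (r * x$1 + s * x$2) = (p * s - q * r) * x$1"
       "- r * (p * x$1 + q * x$2) + p * (r * x$1 + s * x$2) = (p * s - q * r) * x$2"
    by (simp_all add: algebra_simps)
  with assms show ?thesis by (simp add: vec2_eq_iff)
qed

lemma lin2_int_plane:
  assumes "p \<in> \<int>" "q \<in> \<int>" "r \<in> \<int>" "s \<in> \<int>" "x \<in> int_plane"
  shows "lin2 p q r s x \<in> int_plane"
  using assms by (simp add: int_plane_def)

lemma sector_commute: "sector u v = sector v u"
  unfolding sector_def by (metis (no_types, lifting) add.commute)

lemma linear_image_sector:
  assumes "linear L"
  shows "L ` sector u v = sector (L u) (L v)"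
proof -
  have "L (s *\<^sub>R u + t *\<^sub>R v) = s *\<^sub>R L u + t *\<^sub>R L v" for s t
    using assms by (simp add: linear_add linear_scale)
  then show ?thesis
    unfolding sector_def by (auto simp: image_iff) metis
qed

lemma sector_rays: "u \<in> sector u v" "v \<in> sector u v"
proof -
  have "u = 1 *\<^sub>R u + 0 *\<^sub>R v" "v = 0 *\<^sub>R u + 1 *\<^sub>R v" by simp_all
  then show "u \<in> sector u v" "v \<in> sector u v"
    unfolding sector_def by (blast intro: zero_le_one order_refl)+
qed

lemma cramer2:
  assumes "det2 u v \<noteq> 0"
  shows "x = (det2 x v / det2 u v) *\<^sub>R u + (det2 u x / det2 u v) *\<^sub>R v"
proof -
  have "det2 u v * x$1 = det2 x v * u$1 + det2 u x * v$1"
       "det2 u v * x$2 = det2 x v * u$2 + det2 u x * v$2"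
    by (simp_all add: det2_def algebra_simps)
  with assms show ?thesis by (simp add: vec2_eq_iff field_simps)
qed

text \<open>By Cramer's rule the coefficients of \<open>x\<close> in the basis \<open>u\<close>,
  \<open>v\<close> are \<open>det2 x v / det2 u v\<close> and \<open>det2 u x / det2 u v\<close>;
  the denominator is positive, so only the numerators decide their signs.\<close>

lemma sector_eq_det2:
  assumes "0 < det2 u v"
  shows "sector u v = {x. 0 \<le> det2 u x \<and> 0 \<le> det2 x v}"
proof (intro set_eqI iffI)
  fix x assume "x \<in> sector u v"
  then obtain s t where st: "0 \<le> s" "0 \<le> t" "x = s *\<^sub>R u + t *\<^sub>R v"
    by (auto simp: sector_def)
  then have "det2 u x = t * det2 u v" "det2 x v = s * det2 u v"
    by (simp_all add: det2_def algebra_simps)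
  with st assms show "x \<in> {x. 0 \<le> det2 u x \<and> 0 \<le> det2 x v}" by simp
next
  fix x assume "x \<in> {x. 0 \<le> det2 u x \<and> 0 \<le> det2 x v}"
  with assms have "0 \<le> det2 x v / det2 u v" "0 \<le> det2 u x / det2 u v" by simp_all
  then show "x \<in> sector u v"
    unfolding sector_def using cramer2[of u v x] assms by auto
qed

lemma det2_eq_inner: "det2 u x = vector [- u$2, u$1] \<bullet> x" "det2 x v = vector [v$2, - v$1] \<bullet> x"
  by (simp_all add: det2_def inner_vec_def sum_2 algebra_simps)

text \<open>As an intersection of two half-planes a sector inherits convexity, and its interior is
  obtained by making both inequalities strict.\<close>

lemma sector_eq_halfspaces:
  assumes "0 < det2 u v"
  shows "sector u v = {x. vector [- u$2, u$1] \<bullet> x \<ge> 0} \<inter> {x. vector [v$2, - v$1] \<bullet> x \<ge> 0}"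
  unfolding sector_eq_det2[OF assms] det2_eq_inner(1)[of u] det2_eq_inner(2)[of _ v] by blast

lemma convex_sector:
  assumes "0 < det2 u v"
  shows "convex (sector u v)"
  unfolding sector_eq_halfspaces[OF assms] by (intro convex_Int convex_halfspace_ge)

lemma interior_sector:
  assumes "0 < det2 u v"
  shows "interior (sector u v) = {x. 0 < det2 u x \<and> 0 < det2 x v}"
proof -
  have "vector [- u$2, u$1] \<noteq> (0::real^2)" "vector [v$2, - v$1] \<noteq> (0::real^2)"
    using assms by (auto simp: vec2_eq_iff det2_def)
  then show ?thesis
    unfolding sector_eq_halfspaces[OF assms] interior_Int det2_eq_inner(1)[of u] det2_eq_inner(2)[of _ v]
    by (simp only: interior_halfspace_ge Int_def mem_Collect_eq) simp
qed

text \<open>Turns the fan conditions into linear inequalities for a concrete list of rays.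
  \<open>zip vs (rotate1 vs)\<close> lists the cyclically consecutive pairs, and
  \<open>sorted_wrt\<close> compares each two sectors once; this suffices because disjointness of
  interiors is symmetric.\<close>

lemma fan_regionsI:
  fixes vs :: "(real^2) list"
  defines "ps \<equiv> zip vs (rotate1 vs)"
  assumes turn: "\<forall>(u, v)\<in>set ps. 0 < det2 u v"
    and cover: "\<And>x. \<exists>(u, v)\<in>set ps. 0 \<le> det2 u x \<and> 0 \<le> det2 x v"
    and disj: "sorted_wrt (\<lambda>(u, v) (u', v'). \<forall>x.
        \<not> (0 < det2 u x \<and> 0 < det2 x v \<and> 0 < det2 u' x \<and> 0 < det2 x v')) ps"
  shows "fan_regions ((\<lambda>(u, v). sector u v) ` set ps)"
proof -
  let ?n = "length vs"
  have len: "length ps = ?n" and nth: "i < ?n \<Longrightarrow> ps ! i = (vs ! i, vs ! (Suc i mod ?n))" for i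
    by (simp_all add: ps_def nth_rotate1)
  have det: "0 < det2 (vs ! i) (vs ! (Suc i mod ?n))" if "i < ?n" for i
    using turn nth_mem[of i ps] that len nth by force
  have "(\<lambda>(u, v). sector u v) ` set ps = {sector (vs ! i) (vs ! (Suc i mod ?n)) | i. i < ?n}"
    unfolding set_conv_nth len using nth by (auto simp: image_iff) force+
  also have "\<dots> = {sector (vs ! (i mod ?n)) (vs ! (Suc i mod ?n)) | i. i < ?n}"
    by (intro Collect_cong ex_cong1) auto
  finally have "(\<lambda>(u, v). sector u v) ` set ps =
      {sector (vs ! (i mod ?n)) (vs ! (Suc i mod ?n)) | i. i < ?n}" .
  moreover have "\<forall>i<?n. 0 < vs ! (i mod ?n) $ 1 * vs ! (Suc i mod ?n) $ 2
      - vs ! (i mod ?n) $ 2 * vs ! (Suc i mod ?n) $ 1"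
    using det by (simp add: det2_def)
  ultimately have "let n = length vs; v = (\<lambda>i. vs ! (i mod n)) in
          (\<forall>i<n. 0 < v i $ 1 * v (Suc i) $ 2 - v i $ 2 * v (Suc i) $ 1) \<and>
          (\<lambda>(u, v). sector u v) ` set ps = {sector (v i) (v (Suc i)) | i. i < n}"
    unfolding Let_def by blast
  moreover have "x \<in> \<Union>((\<lambda>(u, v). sector u v) ` set ps)" for x
    using cover[of x] turn sector_eq_det2 by fastforce
  moreover have "interior (sector u v) \<inter> interior (sector u' v') = {}"
    if "(u, v) \<in> set ps" "(u', v') \<in> set ps" "(u, v) \<noteq> (u', v')" for u v u' v'
  proof -
    obtain i j where ij: "i < length ps" "j < length ps" "ps ! i = (u, v)" "ps ! j = (u', v')"
      using \<open>(u, v) \<in> set ps\<close> \<open>(u', v') \<in> set ps\<close> by (metis in_set_conv_nth)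
    with that have "i < j \<or> j < i" by (metis linorder_neqE_nat)
    then have "\<not> (0 < det2 u x \<and> 0 < det2 x v \<and> 0 < det2 u' x \<and> 0 < det2 x v')" for x
      using disj ij unfolding sorted_wrt_iff_nth_less by fastforce
    moreover have "0 < det2 u v" "0 < det2 u' v'" using that turn by auto
    ultimately show ?thesis by (auto simp: interior_sector)
  qed
  then have "pairwise (\<lambda>R R'. interior R \<inter> interior R' = {}) ((\<lambda>(u, v). sector u v) ` set ps)"
    unfolding pairwise_def by (auto; blast)
  ultimately show ?thesis
    unfolding fan_regions_def by blast
qed

section \<open>Area and piecewise linear bijections\<close>

text \<open>For sets of finite measure this is the determinant formula. If a set of infinite measure
  had an image of finite measure, the linear left inverse would carry that image back to a set of
  finite measure.\<close>

lemma lebesgue_linear_image_det_1: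
  fixes L :: "real^('n::{finite,wellorder}) \<Rightarrow> real^('n::{finite,wellorder})"
  assumes L: "linear L" "\<bar>det (matrix L)\<bar> = 1" and X: "X \<in> sets lebesgue"
  shows "L ` X \<in> sets lebesgue \<and> emeasure lebesgue (L ` X) = emeasure lebesgue X"
proof
  show LX: "L ` X \<in> sets lebesgue"
    using X L by (intro differentiable_image_in_sets_lebesgue)
      (auto simp: linear_imp_differentiable_on)
  have inj: "inj L"
    using L det_nz_iff_inj by force
  show "emeasure lebesgue (L ` X) = emeasure lebesgue X"
  proof (cases "X \<in> lmeasurable")
    case True
    then show ?thesis
      using L(2) measurable_linear_image[OF L(1) True] measure_linear_image[OF L(1) True]
      by (metis emeasure_eq_ennreal_measure fmeasurableD2 mult_1)
  next
    case False
    have "L ` X \<notin> lmeasurable"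
    proof
      assume "L ` X \<in> lmeasurable"
      moreover obtain M where "linear M" "M \<circ> L = id"
        using linear_injective_left_inverse[OF L(1) inj] by blast
      ultimately have "M ` L ` X \<in> lmeasurable" "M ` L ` X = X"
        using measurable_linear_image[of M "L ` X"] by (simp_all only: image_comp image_id id_apply)
      with False show False by simp
    qed
    with False X LX show ?thesis
      unfolding fmeasurable_def by (metis (lifting) infinity_ennreal_def mem_Collect_eq top.not_eq_extremum)
  qed
qed

text \<open>The set is cut into its parts in the interiors of the regions and the remainder in their
  frontiers. Frontiers of convex sets are null, and so are the images of the remainder, since each
  piece is moved by a measure preserving linear map. The interior parts are disjoint and stay
  disjoint by injectivity, so their areas add up before and after \<open>F\<close>.\<close>

lemma area_preservingI:
  fixes F :: "real^2 \<Rightarrow> real^2"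
  assumes fin: "finite \<R>" and cover: "\<Union>\<R> = UNIV" and conv: "\<And>R. R \<in> \<R> \<Longrightarrow> convex R"
    and disj: "pairwise (\<lambda>R R'. interior R \<inter> interior R' = {}) \<R>" and inj: "inj F"
    and lin: "\<And>R. R \<in> \<R> \<Longrightarrow> \<exists>L. linear L \<and> \<bar>det (matrix L)\<bar> = 1 \<and> (\<forall>x\<in>R. F x = L x)"
  shows "area_preserving F"
  unfolding area_preserving_def
proof
  fix X :: "(real^2) set" assume X: "X \<in> sets lebesgue"
  have piece: "F ` Y \<in> sets lebesgue \<and> emeasure lebesgue (F ` Y) = emeasure lebesgue Y"
    if "R \<in> \<R>" "Y \<subseteq> R" "Y \<in> sets lebesgue" for R Y
  proof -
    obtain L where L: "linear L" "\<bar>det (matrix L)\<bar> = 1" "\<forall>x\<in>R. F x = L x"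
      using lin \<open>R \<in> \<R>\<close> by blast
    then have "F ` Y = L ` Y"
      using \<open>Y \<subseteq> R\<close> by (auto intro!: image_cong)
    with lebesgue_linear_image_det_1[OF L(1,2) that(3)] show ?thesis by simp
  qed
  define I where "I = (\<lambda>R. X \<inter> interior R)"
  define N where "N = (\<lambda>R. X \<inter> (R - interior R))"
  have I: "I R \<in> sets lebesgue" for R
    unfolding I_def using X by (intro sets.Int) auto
  have null: "R - interior R \<in> null_sets lebesgue" if "R \<in> \<R>" for R
  proof -
    have "R - interior R \<subseteq> frontier R"
      by (auto simp: frontier_def closure_subset[THEN subsetD])
    then show ?thesis
      using negligible_convex_frontier[OF conv[OF that]] negligible_subset negligible_iff_null_sets
      by blast
  qed
  have N: "N R \<in> null_sets lebesgue" if "R \<in> \<R>" for R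
    unfolding N_def using null_set_Int1[OF null[OF that] X] .
  have FN: "F ` N R \<in> null_sets lebesgue" if "R \<in> \<R>" for R
  proof -
    have "N R \<subseteq> R" by (auto simp: N_def)
    then show ?thesis
      using piece[OF that] N[OF that] unfolding null_sets_def by (metis (lifting) mem_Collect_eq)
  qed
  have dI: "disjoint_family_on I \<R>"
    using disj unfolding I_def disjoint_family_on_def pairwise_def by blast
  then have dFI: "disjoint_family_on (\<lambda>R. F ` I R) \<R>"
    using inj unfolding disjoint_family_on_def by (metis image_Int image_empty)
  have pI: "F ` I R \<in> sets lebesgue \<and> emeasure lebesgue (F ` I R) = emeasure lebesgue (I R)"
    if "R \<in> \<R>" for R
    using piece[OF that _ I] interior_subset unfolding I_def by blast
  have Xeq: "X = (\<Union>R\<in>\<R>. I R) \<union> (\<Union>R\<in>\<R>. N R)"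
  proof -
    have "X = (\<Union>R\<in>\<R>. X \<inter> R)" using cover by auto
    also have "\<dots> = (\<Union>R\<in>\<R>. I R \<union> N R)"
      unfolding I_def N_def using interior_subset by (intro SUP_cong) blast+
    finally show ?thesis by blast
  qed
  then have FXeq: "F ` X = (\<Union>R\<in>\<R>. F ` I R) \<union> (\<Union>R\<in>\<R>. F ` N R)"
    by (metis image_Un image_UN)
  have U: "(\<Union>R\<in>\<R>. I R) \<in> sets lebesgue" "(\<Union>R\<in>\<R>. F ` I R) \<in> sets lebesgue"
    using I pI fin by (auto intro!: sets.finite_UN)
  have NU: "(\<Union>R\<in>\<R>. N R) \<in> null_sets lebesgue" "(\<Union>R\<in>\<R>. F ` N R) \<in> null_sets lebesgue"
    using N FN fin by (auto intro!: null_sets.finite_UN)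
  have "emeasure lebesgue (F ` X) = emeasure lebesgue (\<Union>R\<in>\<R>. F ` I R)"
    unfolding FXeq by (rule emeasure_Un_null_set[OF U(2) NU(2)])
  also have "\<dots> = (\<Sum>R\<in>\<R>. emeasure lebesgue (F ` I R))"
    using pI dFI fin by (intro sum_emeasure[symmetric]) auto
  also have "\<dots> = (\<Sum>R\<in>\<R>. emeasure lebesgue (I R))"
    by (rule sum.cong) (use pI in blast)+
  also have "\<dots> = emeasure lebesgue (\<Union>R\<in>\<R>. I R)"
    using I dI fin by (intro sum_emeasure) auto
  also have "\<dots> = emeasure lebesgue X"
    using emeasure_Un_null_set[OF U(1) NU(1)] Xeq by simp
  finally have "emeasure lebesgue (F ` X) = emeasure lebesgue X" .
  moreover have "F ` X \<in> sets lebesgue"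
    unfolding FXeq using U(2) NU(2) by auto
  ultimately show "F ` X \<in> sets lebesgue \<and> emeasure lebesgue (F ` X) = emeasure lebesgue X" by simp
qed

section \<open>From a table of rays and matrices to linearity regions with images\<close>

text \<open>Two independent rays of the sector form a basis of the plane.\<close>

lemma linear_eq_on_sector:
  assumes "0 < det2 u v" "linear L" "linear L'" "\<And>x. x \<in> sector u v \<Longrightarrow> L x = L' x"
  shows "L = L'"
proof
  fix x
  have "L u = L' u" "L v = L' v" using assms(4) sector_rays by blast+
  moreover obtain s t where "x = s *\<^sub>R u + t *\<^sub>R v"
    using cramer2[of u v x] assms(1) by auto
  ultimately show "L x = L' x"
    using assms(2,3) by (simp add: linear_add linear_scale)
qed

lemma lin2_inject: "lin2 p q r s = lin2 p' q' r' s' \<longleftrightarrow> (p, q, r, s) = (p', q', r', s')"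
proof
  assume "lin2 p q r s = lin2 p' q' r' s'"
  then have "lin2 p q r s (vector [1, 0]) = lin2 p' q' r' s' (vector [1, 0])"
            "lin2 p q r s (vector [0, 1]) = lin2 p' q' r' s' (vector [0, 1])"
    by simp_all
  then show "(p, q, r, s) = (p', q', r', s')"
    by (simp add: vec2_eq_iff)
qed simp

text \<open>An entry of \<open>qs\<close> holds the two rays of a sector, then the matrix of
  \<open>F\<close> there by rows; the codomain sector is spanned by the images of the rays. Distinct
  matrices show that no two regions can be merged, and integer matrices of determinant 1 map the
  lattice points of a sector onto those of its image.\<close>

lemma piecewise_linear_area_preservingI:
  fixes qs :: "((real^2) \<times> (real^2) \<times> real \<times> real \<times> real \<times> real) list"
  defines "ps \<equiv> map (\<lambda>(u, v, p, q, r, s).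
                 (sector u v, sector (lin2 p q r s u) (lin2 p q r s v))) qs"
  assumes T: "\<And>x. x \<in> int_plane \<Longrightarrow> T x = F x" and inj: "inj F"
    and det: "\<forall>(u, v, _)\<in>set qs. 0 < det2 u v"
    and unimod: "\<forall>(_, _, p, q, r, s)\<in>set qs.
        p \<in> \<int> \<and> q \<in> \<int> \<and> r \<in> \<int> \<and> s \<in> \<int> \<and> p * s - q * r = 1"
    and dist: "distinct (map (\<lambda>(_, _, m). m) qs)"
    and F: "\<forall>(u, v, p, q, r, s)\<in>set qs. \<forall>x\<in>sector u v. F x = lin2 p q r s x"
    and fans: "similar_fans (fst ` set ps) (snd ` set ps)"
  shows "piecewise_linear_area_preserving T ps"
proof -
  have fan: "fan_regions (fst ` set ps)" using fans by (simp add: similar_fans_def)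
  have fst_ps: "fst ` set ps = (\<lambda>(u, v, _). sector u v) ` set qs"
    by (force simp: ps_def image_iff)
  have "area_preserving F"
  proof (rule area_preservingI[OF _ _ _ _ inj])
    show "\<Union>(fst ` set ps) = UNIV"
      "pairwise (\<lambda>R R'. interior R \<inter> interior R' = {}) (fst ` set ps)"
      using fan by (auto simp: fan_regions_def)
    show "convex R" if "R \<in> fst ` set ps" for R
      using that det convex_sector unfolding fst_ps by fastforce
    fix R assume "R \<in> fst ` set ps"
    then obtain u v p q r s where "(u, v, p, q, r, s) \<in> set qs" "R = sector u v"
      unfolding fst_ps by auto
    then show "\<exists>L. linear L \<and> \<bar>det (matrix L)\<bar> = 1 \<and> (\<forall>x\<in>R. F x = L x)"
      using unimod F linear_lin2 det_matrix_lin2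
      by (intro exI[of _ "lin2 p q r s"]) fastforce
  qed simp
  moreover have "linearity_regions F (fst ` set ps)"
    unfolding linearity_regions_def
  proof (intro conjI ballI impI notI)
    fix R assume "R \<in> fst ` set ps"
    then show "agrees_with_linear_on F R"
      unfolding fst_ps agrees_with_linear_on_def using F linear_lin2 by fastforce
    fix R' assume "R' \<in> fst ` set ps" "R \<noteq> R'" "agrees_with_linear_on F (R \<union> R')"
    then obtain L where L: "linear L" "\<And>x. x \<in> R \<union> R' \<Longrightarrow> F x = L x"
      by (auto simp: agrees_with_linear_on_def)
    \<comment> \<open>A linear map that agrees with \<open>F\<close> on both regions would have to
      equal the matrix of each of them; \<open>dist\<close> then makes the two entries of
      \<open>qs\<close> equal.\<close>
    have *: "L = lin2 p q r s"
      if "(u, v, p, q, r, s) \<in> set qs" "sector u v \<subseteq> R \<union> R'" for u v p q r s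
    proof (rule linear_eq_on_sector[OF _ L(1) linear_lin2])
      show "0 < det2 u v" using det that by auto
      fix x assume "x \<in> sector u v"
      moreover from this have "F x = L x" using L(2) that by blast
      ultimately show "L x = lin2 p q r s x" using F that(1) by fastforce
    qed
    obtain u v p q r s where 1: "(u, v, p, q, r, s) \<in> set qs" "R = sector u v"
      using \<open>R \<in> fst ` set ps\<close> unfolding fst_ps by auto
    obtain u' v' p' q' r' s' where 2: "(u', v', p', q', r', s') \<in> set qs" "R' = sector u' v'"
      using \<open>R' \<in> fst ` set ps\<close> unfolding fst_ps by auto
    have "(p, q, r, s) = (p', q', r', s')"
      using *[OF 1(1)] *[OF 2(1)] 1 2 lin2_inject by blast
    then have "(u, v, p, q, r, s) = (u', v', p', q', r', s')"
      using inj_onD[OF _ _ 1(1) 2(1)] dist unfolding distinct_map by fastforce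
    with 1 2 \<open>R \<noteq> R'\<close> show False by simp
  qed (rule fan)
  moreover have "F ` R = R' \<and> T ` (R \<inter> int_plane) = R' \<inter> int_plane"
    if "(R, R') \<in> set ps" for R R'
  proof -
    obtain u v p q r s where q: "(u, v, p, q, r, s) \<in> set qs"
      and R: "R = sector u v" "R' = sector (lin2 p q r s u) (lin2 p q r s v)"
      using \<open>(R, R') \<in> set ps\<close> unfolding ps_def by auto
    have pq: "p \<in> \<int>" "q \<in> \<int>" "r \<in> \<int>" "s \<in> \<int>" "p * s - q * r = 1"
      using unimod q by auto
    have FR: "F x = lin2 p q r s x" if "x \<in> R" for x
      using F q that R by fastforce
    then have 1: "F ` R = R'"
      using R linear_image_sector[OF linear_lin2] by (metis image_cong)
    have "T ` (R \<inter> int_plane) = F ` (R \<inter> int_plane)"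
      using T by (intro image_cong) auto
    also have "\<dots> = R' \<inter> int_plane"
    proof (intro equalityI subsetI)
      fix y assume "y \<in> F ` (R \<inter> int_plane)"
      then show "y \<in> R' \<inter> int_plane"
        using 1 FR pq lin2_int_plane by auto
    next
      fix y assume y: "y \<in> R' \<inter> int_plane"
      then obtain x where x: "x \<in> R" "y = F x" using 1 by auto
      \<comment> \<open>The integral inverse matrix shows that the preimage of a lattice point is
        again a lattice point.\<close>
      then have "x = lin2 s (-q) (-r) p y"
        using FR lin2_inverse pq by metis
      then have "x \<in> int_plane"
        using y pq lin2_int_plane by auto
      with x show "y \<in> F ` (R \<inter> int_plane)" by blast
    qed
    finally show ?thesis using 1 by simp
  qed
  ultimately show ?thesis
    unfolding piecewise_linear_area_preserving_def using T fans by blast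
qed

section \<open>The action of mapping classes on curve systems\<close>

text \<open>The topological content of membership in \<open>Diff\<close>. The inverse
  \<open>k\<close> is carried along so that every fact about \<open>f\<close> can also be applied to
  \<open>k\<close>.\<close>

definition bd_homeo :: "(complex \<Rightarrow> complex) \<Rightarrow> (complex \<Rightarrow> complex) \<Rightarrow> bool" where
  "bd_homeo f k \<longleftrightarrow> homeomorphism disc3 disc3 f k \<and> (\<forall>z\<in>bd_disc3. f z = z)"

lemma bd_disc3_subset: "bd_disc3 \<subseteq> disc3"
  by (auto simp: disc3_def)

lemma interior_disc3: "interior disc3 = disc3 - bd_disc3"
proof -
  have "interior (- {-1, 0, 1::complex}) = - {-1, 0, 1}"
    by (intro interior_open open_Compl finite_imp_closed) simp
  then have "interior disc3 = ball 0 2 - {-1, 0, 1}"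
    unfolding disc3_def Diff_eq by (simp add: interior_Int)
  moreover have "ball 0 2 = cball 0 2 - sphere (0::complex) 2"
    by force
  ultimately show ?thesis unfolding disc3_def by blast
qed

text \<open>Order 0 of \<open>Ck_on\<close> is continuity of the smooth extension, which is then
  restricted to \<open>A\<close>.\<close>

lemma smooth_on_imp_continuous_on:
  assumes "smooth_on A f"
  shows "continuous_on A f"
proof -
  obtain U g where g: "A \<subseteq> U" "\<forall>k. Ck_on k g U" "\<forall>x\<in>A. g x = f x"
    using assms unfolding smooth_on_def by blast
  from g(2) have "Ck_on 0 g U" by blast
  with g show ?thesis
    by (metis Ck_on.simps(1) continuous_on_cong continuous_on_subset)
qed

lemma Diff_imp_bd_homeo:
  assumes "f \<in> Diff"
  shows "bd_homeo f (inv_into disc3 f)"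
proof -
  have f: "bij_betw f disc3 disc3" using assms by (simp add: Diff_def)
  note k = bij_betw_inv_into[OF f]
  show ?thesis
    using assms smooth_on_imp_continuous_on bij_betw_imp_surj_on[OF f] bij_betw_imp_surj_on[OF k]
      bij_betw_inv_into_left[OF f] bij_betw_inv_into_right[OF f]
    unfolding Diff_def bd_homeo_def homeomorphism_def by blast
qed

lemma bd_homeo_sym:
  assumes "bd_homeo f k"
  shows "bd_homeo k f"
  using assms bd_disc3_subset unfolding bd_homeo_def
  by (metis homeomorphism_apply1 homeomorphism_sym subsetD)

text \<open>The interior is the complement of the boundary circle in \<open>disc3\<close>, and
  \<open>f\<close> is a bijection of \<open>disc3\<close> that fixes this circle.\<close>

lemma bd_homeo_image_interior:
  assumes "bd_homeo f k"
  shows "f ` interior disc3 = interior disc3"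
proof -
  have "inj_on f disc3" "f ` disc3 = disc3" "f ` bd_disc3 = bd_disc3"
    using assms unfolding bd_homeo_def homeomorphism_def
    by (auto intro: inj_on_inverseI simp: image_iff)
  then show ?thesis
    unfolding interior_disc3 using bd_disc3_subset by (metis inj_on_image_set_diff Diff_subset)
qed

lemma bd_homeo_continuous: "bd_homeo f k \<Longrightarrow> X \<subseteq> disc3 \<Longrightarrow> continuous_on X f"
  unfolding bd_homeo_def homeomorphism_def by (blast intro: continuous_on_subset)

lemma bd_homeo_inj: "bd_homeo f k \<Longrightarrow> X \<subseteq> disc3 \<Longrightarrow> inj_on f X"
  unfolding bd_homeo_def homeomorphism_def by (metis inj_onI subsetD)

lemma bd_homeo_inverse: "bd_homeo f k \<Longrightarrow> x \<in> disc3 \<Longrightarrow> k (f x) = x"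
  unfolding bd_homeo_def by (metis homeomorphism_apply1)

lemma bd_homeo_image_subset: "bd_homeo f k \<Longrightarrow> X \<subseteq> disc3 \<Longrightarrow> f ` X \<subseteq> disc3"
  unfolding bd_homeo_def homeomorphism_def by blast

lemma bd_homeo_image_inverse: "bd_homeo f k \<Longrightarrow> X \<subseteq> disc3 \<Longrightarrow> k ` f ` X = X"
  using bd_homeo_inverse by (force simp: image_image)

section \<open>Images of curves and multicurves\<close>

text \<open>Transports the parametrizations of discs and annuli that occur in the
  \<open>bounds_\<close> predicates.\<close>

lemma bd_homeo_compose:
  assumes f: "bd_homeo f k" and D: "D \<subseteq> disc3" and h: "homeomorphism S D h h'"
  shows "homeomorphism S (f ` D) (f \<circ> h) (h' \<circ> k)"
proof (rule homeomorphism_compose[OF h])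
  show "homeomorphism D (f ` D) f k"
    using f D bd_homeo_image_subset[OF f D] unfolding bd_homeo_def
    by (blast intro: homeomorphism_of_subsets)
qed

lemma bounds_disc_image:
  assumes f: "bd_homeo f k" and "bounds_disc c"
  shows "bounds_disc (f ` c)"
proof -
  obtain D h h' where D: "D \<subseteq> disc3" and h: "homeomorphism (cball (0::complex) 1) D h h'"
    and c: "h ` sphere 0 1 = c"
    using assms(2) unfolding bounds_disc_def by blast
  have *: "(f \<circ> h) ` sphere 0 1 = f ` c" using c by (metis image_comp)
  show ?thesis unfolding bounds_disc_def
  proof (intro exI conjI)
    show "f ` D \<subseteq> disc3" by (rule bd_homeo_image_subset[OF f D])
    show "homeomorphism (cball (0::complex) 1) (f ` D) (f \<circ> h) (h' \<circ> k)"
      by (rule bd_homeo_compose[OF f D h])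
  qed (fact *)+
qed

text \<open>Beyond composing the parametrization with \<open>f\<close>, closedness in
  \<open>disc3\<close> has to be kept; a homeomorphism of \<open>disc3\<close> onto itself is a
  closed map.\<close>

lemma bounds_punctured_disc_image:
  assumes f: "bd_homeo f k" and "bounds_punctured_disc c"
  shows "bounds_punctured_disc (f ` c)"
proof -
  obtain D h h' where D: "D \<subseteq> disc3" and cl: "closedin (top_of_set disc3) D"
    and h: "homeomorphism (cball (0::complex) 1 - {0}) D h h'" and c: "h ` sphere 0 1 = c"
    using assms(2) unfolding bounds_punctured_disc_def by blast
  have *: "(f \<circ> h) ` sphere 0 1 = f ` c" using c by (metis image_comp)
  have **: "closedin (top_of_set disc3) (f ` D)"
    using f cl homeomorphism_imp_closed_map unfolding bd_homeo_def by blast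
  show ?thesis unfolding bounds_punctured_disc_def
  proof (intro exI conjI)
    show "f ` D \<subseteq> disc3" by (rule bd_homeo_image_subset[OF f D])
    show "homeomorphism (cball (0::complex) 1 - {0}) (f ` D) (f \<circ> h) (h' \<circ> k)"
      by (rule bd_homeo_compose[OF f D h])
  qed (fact * **)+
qed

text \<open>The outer circle of the annulus still goes to \<open>bd_disc3\<close>, because
  \<open>f\<close> fixes the boundary pointwise.\<close>

lemma bounds_annulus_with_boundary_image:
  assumes f: "bd_homeo f k" and "bounds_annulus_with_boundary c"
  shows "bounds_annulus_with_boundary (f ` c)"
proof -
  obtain D h h' where D: "D \<subseteq> disc3" and h: "homeomorphism (cball (0::complex) 2 - ball 0 1) D h h'"
    and c: "h ` sphere 0 1 = c" and bd: "h ` sphere 0 2 = bd_disc3"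
    using assms(2) unfolding bounds_annulus_with_boundary_def by blast
  have "f ` bd_disc3 = bd_disc3" using f by (simp add: bd_homeo_def)
  then have *: "(f \<circ> h) ` sphere 0 1 = f ` c" "(f \<circ> h) ` sphere 0 2 = bd_disc3"
    using c bd by (metis image_comp)+
  show ?thesis unfolding bounds_annulus_with_boundary_def
  proof (intro exI conjI)
    show "f ` D \<subseteq> disc3" by (rule bd_homeo_image_subset[OF f D])
    show "homeomorphism (cball (0::complex) 2 - ball 0 1) (f ` D) (f \<circ> h) (h' \<circ> k)"
      by (rule bd_homeo_compose[OF f D h])
  qed (fact *)+
qed

text \<open>If the image curve bounded one of the forbidden regions, applying the inverse
  \<open>k\<close> would give such a region for \<open>c\<close> itself.\<close>

lemma essential_image:
  assumes f: "bd_homeo f k" and "c \<subseteq> disc3" "essential c"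
  shows "essential (f ` c)"
  using assms(3) bounds_disc_image[OF bd_homeo_sym[OF f]]
    bounds_punctured_disc_image[OF bd_homeo_sym[OF f]]
    bounds_annulus_with_boundary_image[OF bd_homeo_sym[OF f]]
    bd_homeo_image_inverse[OF assms(1,2)]
  unfolding essential_def by metis

lemma simple_closed_curve_image:
  assumes f: "bd_homeo f k" and c: "simple_closed_curve c"
  shows "simple_closed_curve (f ` c)"
proof -
  obtain \<gamma> where \<gamma>: "simple_path \<gamma>" "pathfinish \<gamma> = pathstart \<gamma>" "path_image \<gamma> = c"
    and ci: "c \<subseteq> interior disc3"
    using c unfolding simple_closed_curve_def by blast
  have cd: "c \<subseteq> disc3" using ci interior_subset by blast
  have "simple_path (f \<circ> \<gamma>)"
    using \<gamma> bd_homeo_continuous[OF f cd] bd_homeo_inj[OF f cd]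
    by (intro simple_path_continuous_image) auto
  moreover have "pathfinish (f \<circ> \<gamma>) = pathstart (f \<circ> \<gamma>)" "path_image (f \<circ> \<gamma>) = f ` c"
    using \<gamma> by (simp_all add: pathfinish_compose pathstart_compose path_image_compose)
  moreover have "f ` c \<subseteq> interior disc3"
    using ci bd_homeo_image_interior[OF f] by blast
  ultimately show ?thesis unfolding simple_closed_curve_def by blast
qed

lemma multicurve_subset_interior: "l \<in> multicurves \<Longrightarrow> l \<subseteq> interior disc3"
  unfolding multicurves_def simple_closed_curve_def by blast

lemma multicurve_subset_disc3: "l \<in> multicurves \<Longrightarrow> l \<subseteq> disc3"
  using multicurve_subset_interior interior_subset by blast

text \<open>Compactness makes a continuous injection of a multicurve a homeomorphism onto its
  image.\<close>

lemma compact_multicurve: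
  assumes "l \<in> multicurves"
  shows "compact l"
proof -
  obtain C where "finite C" "l = \<Union>C" "\<forall>c\<in>C. simple_closed_curve c"
    using assms unfolding multicurves_def by blast
  moreover have "compact c" if "simple_closed_curve c" for c
    using that unfolding simple_closed_curve_def
    by (metis compact_path_image simple_path_imp_path)
  ultimately show ?thesis by (simp add: compact_Union)
qed

lemma multicurve_image:
  assumes f: "bd_homeo f k" and l: "l \<in> multicurves"
  shows "f ` l \<in> multicurves"
proof -
  obtain C where C: "finite C" "C \<noteq> {}" "pairwise disjnt C" "l = \<Union>C"
    "\<forall>c\<in>C. simple_closed_curve c \<and> essential c"
    using l unfolding multicurves_def by blast
  have sub: "c \<subseteq> disc3" if "c \<in> C" for c
    using that C(4) multicurve_subset_disc3[OF l] by blast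
  have "pairwise disjnt ((`) f ` C)"
    unfolding pairwise_def
  proof clarsimp
    fix c c' assume cc: "c \<in> C" "c' \<in> C" "f ` c \<noteq> f ` c'"
    then have "disjnt c c'" using C(3) by (metis pairwise_def)
    then show "disjnt (f ` c) (f ` c')"
      using bd_homeo_inj[OF f order_refl] sub cc
      by (metis disjnt_def image_empty inj_on_image_Int)
  qed
  moreover have "f ` l = \<Union>((`) f ` C)" using C(4) by blast
  moreover have "\<forall>c\<in>(`) f ` C. simple_closed_curve c \<and> essential c"
    using C(5) sub by (auto intro: simple_closed_curve_image[OF f] essential_image[OF f])
  moreover have "finite ((`) f ` C)" "(`) f ` C \<noteq> {}" using C by simp_all
  ultimately show ?thesis unfolding multicurves_def by blast
qed

section \<open>Isotopy of multicurves as an equivalence relation\<close>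

text \<open>Records the range of every stage of the homotopy in the property itself, so that a stage
  can be composed with a map that is injective only on \<open>disc3\<close>.\<close>

lemma homotopic_with_canon_image_subset:
  assumes "homotopic_with_canon P X Y f g"
  shows "homotopic_with_canon (\<lambda>h. P h \<and> h ` X \<subseteq> Y) X Y f g"
  using assms by (rule homotopic_with_mono) auto

text \<open>Lets an isotopy within \<open>disc3\<close> whose stages keep a multicurve in the
  interior be read as one within the interior.\<close>

lemma homotopic_with_canon_restrict_codomain:
  assumes "homotopic_with_canon P X Y f g" and "\<And>h. P h \<Longrightarrow> h ` X \<subseteq> Z"
  shows "homotopic_with_canon P X Z f g"
proof -
  obtain h :: "real \<times> _ \<Rightarrow> _"
    where "continuous_on ({0..1} \<times> X) h" "\<forall>x. h (0, x) = f x" "\<forall>x. h (1, x) = g x"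
    "\<forall>t\<in>{0..1}. P (\<lambda>x. h (t, x))"
    using assms(1) unfolding homotopic_with_def by (auto simp: continuous_map_subtopology_eu)
  moreover from this have "h ` ({0..1} \<times> X) \<subseteq> Z"
    using assms(2) by blast
  ultimately show ?thesis
    unfolding homotopic_with_def
    by (intro exI[of _ h]) auto
qed

text \<open>The isotopies constructed below start at composites such as \<open>f \<circ> k\<close>,
  which equal the identity on the multicurve but not necessarily elsewhere.\<close>

lemma curve_isotopyI:
  assumes "l \<in> multicurves" "l' \<in> multicurves"
    and hom: "homotopic_with_canon (\<lambda>h. inj_on h l) l (interior disc3) f g"
    and f: "\<And>x. x \<in> l \<Longrightarrow> f x = x" and g: "g ` l = l'"
  shows "(l, l') \<in> curve_isotopy"
proof -
  have "homotopic_with_canon (\<lambda>h. inj_on h l) l (interior disc3) id g"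
    using f by (intro homotopic_with_eq[OF hom]) (auto cong: inj_on_cong)
  with assms show ?thesis unfolding curve_isotopy_def by blast
qed

text \<open>The end map of the isotopy comes with an inverse, by compactness of the multicurve; this
  inverse is what allows isotopies to be reversed.\<close>

lemma curve_isotopyE:
  assumes "(l, l') \<in> curve_isotopy"
  obtains g k where "l \<in> multicurves" "l' \<in> multicurves"
    "homotopic_with_canon (\<lambda>h. inj_on h l) l (interior disc3) id g" "homeomorphism l l' g k"
proof -
  obtain g where g: "l \<in> multicurves" "l' \<in> multicurves"
    "homotopic_with_canon (\<lambda>h. inj_on h l) l (interior disc3) id g" "g ` l = l'"
    using assms unfolding curve_isotopy_def by blast
  moreover obtain k where "homeomorphism l l' g k"
    using homeomorphism_compact[OF compact_multicurve] g
      homotopic_with_imp_continuous[OF g(3)] homotopic_with_imp_property[OF g(3)] by metis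
  ultimately show thesis using that by blast
qed

text \<open>For symmetry the isotopy is run backwards and precomposed with the inverse of its end
  map, so that it starts at the identity on \<open>l'\<close>. For transitivity the second isotopy
  is precomposed with the end map of the first and appended to it.\<close>

lemma equiv_curve_isotopy: "equiv multicurves curve_isotopy"
proof (rule equivI)
  show "curve_isotopy \<subseteq> multicurves \<times> multicurves"
    unfolding curve_isotopy_def by blast
  show "refl_on multicurves curve_isotopy"
  proof (rule refl_onI)
    fix l assume l: "l \<in> multicurves"
    then show "(l, l) \<in> curve_isotopy"
      using multicurve_subset_interior[OF l]
      by (intro curve_isotopyI[of _ _ id id]) (auto intro: homotopic_with_equal)
  qed
  show "sym curve_isotopy"
  proof (rule symI)
    fix l l' assume "(l, l') \<in> curve_isotopy"
    then obtain g k where g: "l \<in> multicurves" "l' \<in> multicurves"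
      "homotopic_with_canon (\<lambda>h. inj_on h l) l (interior disc3) id g" "homeomorphism l l' g k"
      by (rule curve_isotopyE)
    have k: "continuous_on l' k" "k ` l' = l" "inj_on k l'" "\<And>x. x \<in> l' \<Longrightarrow> g (k x) = x"
      using g(4) unfolding homeomorphism_def by (auto intro: inj_on_inverseI)
    have "homotopic_with_canon (\<lambda>h. inj_on h l') l' (interior disc3) (g \<circ> k) (id \<circ> k)"
    proof (rule homotopic_with_compose_continuous_right)
      show "homotopic_with_canon (\<lambda>h. inj_on (h \<circ> k) l') l (interior disc3) g id"
        using homotopic_with_symD[OF g(3)] k by (elim homotopic_with_mono) (simp add: comp_inj_on)
    qed (use k in auto)
    with g k show "(l', l) \<in> curve_isotopy"
      by (intro curve_isotopyI[of _ _ "g \<circ> k" "id \<circ> k"]) auto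
  qed
  show "trans curve_isotopy"
  proof (rule transI)
    fix l l' l'' assume "(l, l') \<in> curve_isotopy" "(l', l'') \<in> curve_isotopy"
    obtain g k where g: "l \<in> multicurves" "l' \<in> multicurves"
      "homotopic_with_canon (\<lambda>h. inj_on h l) l (interior disc3) id g" "homeomorphism l l' g k"
      using \<open>(l, l') \<in> curve_isotopy\<close> by (rule curve_isotopyE)
    obtain g' k' where g': "l'' \<in> multicurves"
      "homotopic_with_canon (\<lambda>h. inj_on h l') l' (interior disc3) id g'" "homeomorphism l' l'' g' k'"
      using \<open>(l', l'') \<in> curve_isotopy\<close> by (rule curve_isotopyE)
    have gl: "continuous_on l g" "g ` l = l'" "inj_on g l"
      using g(4) unfolding homeomorphism_def by (auto intro: inj_on_inverseI)
    have "homotopic_with_canon (\<lambda>h. inj_on h l) l (interior disc3) (id \<circ> g) (g' \<circ> g)"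
    proof (rule homotopic_with_compose_continuous_right)
      show "homotopic_with_canon (\<lambda>h. inj_on (h \<circ> g) l) l' (interior disc3) id g'"
        using g'(2) gl by (elim homotopic_with_mono) (simp add: comp_inj_on)
    qed (use gl in auto)
    with g(3) have "homotopic_with_canon (\<lambda>h. inj_on h l) l (interior disc3) id (g' \<circ> g)"
      by (auto intro: homotopic_with_trans)
    moreover have "(g' \<circ> g) ` l = l''"
      using gl g'(3) unfolding homeomorphism_def by (metis image_comp)
    ultimately show "(l, l'') \<in> curve_isotopy"
      using curve_isotopyI[OF g(1) g'(1)] by simp
  qed
qed

text \<open>Conjugation: if the stages \<open>h\<close> move \<open>l\<close> to \<open>l'\<close>,
  then the stages \<open>f \<circ> h \<circ> k\<close> start at the identity on \<open>f\<close>
  l\<open>and move it to\<close>f \<open>l'\<close>.\<close>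

lemma curve_isotopy_image:
  assumes f: "bd_homeo f k" and "(l, l') \<in> curve_isotopy"
  shows "(f ` l, f ` l') \<in> curve_isotopy"
proof -
  obtain g g' where g: "l \<in> multicurves" "l' \<in> multicurves"
    "homotopic_with_canon (\<lambda>h. inj_on h l) l (interior disc3) id g" "homeomorphism l l' g g'"
    using assms(2) by (rule curve_isotopyE)
  have ld: "l \<subseteq> disc3" using multicurve_subset_disc3 g(1) .
  have fl: "f ` l \<subseteq> disc3" using bd_homeo_image_subset[OF f ld] .
  have k: "k ` f ` l = l" "continuous_on (f ` l) k" "inj_on k (f ` l)"
    using bd_homeo_image_inverse[OF f ld] bd_homeo_continuous[OF bd_homeo_sym[OF f] fl]
      bd_homeo_inj[OF bd_homeo_sym[OF f] fl] by auto
  have int: "interior disc3 \<subseteq> disc3" by (rule interior_subset)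
  have "homotopic_with_canon (\<lambda>h. inj_on h l) l (interior disc3) (f \<circ> id) (f \<circ> g)"
  proof (rule homotopic_with_compose_continuous_left)
    show "homotopic_with_canon (\<lambda>h. inj_on (f \<circ> h) l) l (interior disc3) id g"
      using homotopic_with_canon_image_subset[OF g(3)]
      by (rule homotopic_with_mono) (meson bd_homeo_inj comp_inj_on f int order_trans)
    show "continuous_on (interior disc3) f"
      using bd_homeo_continuous[OF f int] .
    show "f \<in> interior disc3 \<rightarrow> interior disc3"
      using bd_homeo_image_interior[OF f] by blast
  qed
  then have "homotopic_with_canon (\<lambda>h. inj_on (h \<circ> k) (f ` l)) l (interior disc3) (f \<circ> id) (f \<circ> g)"
    using k by (elim homotopic_with_mono) (simp add: comp_inj_on)
  then have "homotopic_with_canon (\<lambda>h. inj_on h (f ` l)) (f ` l) (interior disc3)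
      ((f \<circ> id) \<circ> k) ((f \<circ> g) \<circ> k)"
    by (rule homotopic_with_compose_continuous_right) (use k in auto)
  moreover have "((f \<circ> id) \<circ> k) x = x" if "x \<in> f ` l" for x
    using bd_homeo_inverse[OF bd_homeo_sym[OF f], of x] that fl by auto
  moreover have "((f \<circ> g) \<circ> k) ` (f ` l) = f ` l'"
    using k(1) g(4) unfolding homeomorphism_def by (metis image_comp)
  ultimately show ?thesis
    by (rule curve_isotopyI[OF multicurve_image[OF f g(1)] multicurve_image[OF f g(2)]])
qed

text \<open>The stages \<open>h\<close> of the isotopy from \<open>f\<close> to \<open>f'\<close>
  are precomposed with the inverse of \<open>f\<close>; on \<open>f\<close>
  l\<open>this starts at the identity and ends with image\<close>f' \<open>l\<close>.\<close>

lemma curve_isotopy_diff_isotopy: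
  assumes "(f, f') \<in> diff_isotopy" and l: "l \<in> multicurves"
  shows "(f ` l, f' ` l) \<in> curve_isotopy"
proof -
  let ?k = "inv_into disc3 f"
  have fD: "f \<in> Diff" "f' \<in> Diff" and hom: "homotopic_with_canon (\<lambda>h. h \<in> Diff) disc3 disc3 f f'"
    using assms(1) unfolding diff_isotopy_def by auto
  note f = Diff_imp_bd_homeo[OF fD(1)] and f' = Diff_imp_bd_homeo[OF fD(2)]
  have li: "l \<subseteq> interior disc3" using multicurve_subset_interior l .
  have ld: "l \<subseteq> disc3" using multicurve_subset_disc3 l .
  have fl: "f ` l \<subseteq> disc3" using bd_homeo_image_subset[OF f ld] .
  have k: "?k ` f ` l = l" "continuous_on (f ` l) ?k" "inj_on ?k (f ` l)"
    using bd_homeo_image_inverse[OF f ld] bd_homeo_continuous[OF bd_homeo_sym[OF f] fl]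
      bd_homeo_inj[OF bd_homeo_sym[OF f] fl] by auto
  \<comment> \<open>Every stage lies in \<open>Diff\<close>, hence preserves the interior; this is
    what later permits the codomain to shrink from \<open>disc3\<close> to its interior.\<close>
  have "inj_on (h \<circ> ?k) (f ` l) \<and> (h \<circ> ?k) ` f ` l \<subseteq> interior disc3" if "h \<in> Diff" for h
  proof -
    note h = Diff_imp_bd_homeo[OF that]
    have "(h \<circ> ?k) ` f ` l = h ` l" using k(1) by (metis image_comp)
    moreover have "h ` l \<subseteq> interior disc3"
      using bd_homeo_image_interior[OF h] li by blast
    ultimately show ?thesis
      using k bd_homeo_inj[OF h ld] by (simp add: comp_inj_on)
  qed
  then have "homotopic_with_canon (\<lambda>h. inj_on (h \<circ> ?k) (f ` l) \<and> (h \<circ> ?k) ` f ` l \<subseteq> interior disc3)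
      disc3 disc3 f f'"
    using hom by (elim homotopic_with_mono) auto
  then have "homotopic_with_canon (\<lambda>h. inj_on h (f ` l) \<and> h ` f ` l \<subseteq> interior disc3)
      (f ` l) disc3 (f \<circ> ?k) (f' \<circ> ?k)"
    by (rule homotopic_with_compose_continuous_right) (use k ld in auto)
  then have "homotopic_with_canon (\<lambda>h. inj_on h (f ` l) \<and> h ` f ` l \<subseteq> interior disc3)
      (f ` l) (interior disc3) (f \<circ> ?k) (f' \<circ> ?k)"
    by (rule homotopic_with_canon_restrict_codomain) simp
  then have "homotopic_with_canon (\<lambda>h. inj_on h (f ` l)) (f ` l) (interior disc3) (f \<circ> ?k) (f' \<circ> ?k)"
    by (rule homotopic_with_mono) simp
  moreover have "(f \<circ> ?k) x = x" if "x \<in> f ` l" for x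
    using bd_homeo_inverse[OF bd_homeo_sym[OF f], of x] that fl by auto
  moreover have "(f' \<circ> ?k) ` (f ` l) = f' ` l"
    using k(1) by (metis image_comp)
  ultimately show ?thesis
    by (rule curve_isotopyI[OF multicurve_image[OF f l] multicurve_image[OF f' l]])
qed

section \<open>The action of mapping classes on isotopy classes of curves\<close>

lemma Mod_memberD:
  assumes "\<phi> \<in> Mod" "f \<in> \<phi>"
  shows "f \<in> Diff"
  using assms unfolding Mod_def diff_isotopy_def by (auto elim!: quotientE)

lemma curve_systems_memberD:
  assumes "L \<in> curve_systems" "l \<in> L"
  shows "l \<in> multicurves" "L = curve_isotopy `` {l}"
proof -
  obtain m where m: "m \<in> multicurves" "L = curve_isotopy `` {m}"
    using assms(1) unfolding curve_systems_def by (auto elim: quotientE)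
  then show "L = curve_isotopy `` {l}"
    using assms(2) equiv_class_eq[OF equiv_curve_isotopy] by blast
  show "l \<in> multicurves"
    using m assms(2) unfolding curve_isotopy_def by auto
qed

lemma curve_systems_nonempty: "L \<in> curve_systems \<Longrightarrow> L \<noteq> {}"
  unfolding curve_systems_def
  using in_quotient_imp_non_empty[OF equiv_curve_isotopy] by blast

text \<open>Independence of representatives: the union in \<open>act\<close> collapses to the class
  obtained from any one choice of \<open>f\<close> and \<open>l\<close>.\<close>

lemma act_eq_class:
  assumes \<phi>: "\<phi> \<in> Mod" "f \<in> \<phi>" and L: "L \<in> curve_systems" "l \<in> L"
  shows "act \<phi> L = curve_isotopy `` {f ` l}"
proof -
  have "curve_isotopy `` {f' ` l'} = curve_isotopy `` {f ` l}" if "f' \<in> \<phi>" "l' \<in> L" for f' l'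
  proof (rule equiv_class_eq[OF equiv_curve_isotopy])
    note l = curve_systems_memberD[OF L]
    have "(l, l') \<in> curve_isotopy" using l that by blast
    moreover have "bd_homeo f (inv_into disc3 f)"
      using Diff_imp_bd_homeo Mod_memberD[OF \<phi>] .
    ultimately have 1: "(f ` l, f ` l') \<in> curve_isotopy"
      by (blast intro: curve_isotopy_image)
    have l': "l' \<in> multicurves" using curve_systems_memberD[OF L(1)] that by blast
    obtain f0 where f0: "\<phi> = diff_isotopy `` {f0}"
      using \<phi>(1) unfolding Mod_def by (auto elim: quotientE)
    have "(f0 ` l', f ` l') \<in> curve_isotopy" "(f0 ` l', f' ` l') \<in> curve_isotopy"
      using f0 \<phi>(2) that l' by (auto intro: curve_isotopy_diff_isotopy)
    with 1 show "(f' ` l', f ` l) \<in> curve_isotopy"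
      using equiv_curve_isotopy unfolding equiv_def sym_def trans_def by metis
  qed
  then show ?thesis
    unfolding act_def using \<phi>(2) L(2) by blast
qed

lemma act_in_curve_systems:
  assumes \<phi>: "\<phi> \<in> Mod" "\<phi> \<noteq> {}" and L: "L \<in> curve_systems"
  shows "act \<phi> L \<in> curve_systems"
proof -
  obtain f l where fl: "f \<in> \<phi>" "l \<in> L"
    using \<phi> curve_systems_nonempty[OF L] by blast
  have "f ` l \<in> multicurves"
    using multicurve_image[OF Diff_imp_bd_homeo[OF Mod_memberD[OF \<phi>(1) fl(1)]]]
      curve_systems_memberD[OF L fl(2)] by blast
  then show ?thesis
    unfolding act_eq_class[OF \<phi>(1) fl(1) L fl(2)] curve_systems_def by (rule quotientI)
qed

lemma mcg_mult_emptyD: "mcg_mult \<phi> \<psi> \<noteq> {} \<Longrightarrow> \<phi> \<noteq> {} \<and> \<psi> \<noteq> {}"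
  unfolding mcg_mult_def by blast

text \<open>The product is empty unless some composite is a diffeomorphism in the sense of \<open>Diff\<close>; assuming
  it nonempty replaces a proof that composites are smooth.\<close>

lemma act_mcg_mult:
  assumes \<phi>: "\<phi> \<in> Mod" and \<psi>: "\<psi> \<in> Mod" and ne: "mcg_mult \<phi> \<psi> \<noteq> {}" and L: "L \<in> curve_systems"
  shows "act (mcg_mult \<phi> \<psi>) L = act \<phi> (act \<psi> L)"
proof -
  have "curve_isotopy `` {h ` l} = act \<phi> (act \<psi> L)" if h: "h \<in> mcg_mult \<phi> \<psi>" and l: "l \<in> L" for h l
  proof -
    obtain f g where fg: "f \<in> \<phi>" "g \<in> \<psi>" "(f \<circ> g, h) \<in> diff_isotopy"
      using h unfolding mcg_mult_def by blast
    have lm: "l \<in> multicurves" using curve_systems_memberD[OF L l] by blast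
    have gl: "g ` l \<in> act \<psi> L"
      using act_eq_class[OF \<psi> fg(2) L l]
        multicurve_image[OF Diff_imp_bd_homeo[OF Mod_memberD[OF \<psi> fg(2)]] lm]
      by (metis equiv_class_self[OF equiv_curve_isotopy])
    have "act \<psi> L \<in> curve_systems"
      using act_in_curve_systems[OF \<psi> _ L] fg(2) by blast
    then have "act \<phi> (act \<psi> L) = curve_isotopy `` {f ` g ` l}"
      using act_eq_class[OF \<phi> fg(1) _ gl] by blast
    also have "\<dots> = curve_isotopy `` {h ` l}"
      using equiv_class_eq[OF equiv_curve_isotopy curve_isotopy_diff_isotopy[OF fg(3) lm]]
      by (simp add: image_comp)
    finally show ?thesis by simp
  qed
  then show ?thesis
    unfolding act_def[of "mcg_mult \<phi> \<psi>"] using ne curve_systems_nonempty[OF L] by blast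
qed

section \<open>The update rules and their squares\<close>

lemma vector_eta2: "vector [x$1, x$2] = (x::real^2)"
  by (simp add: vec2_eq_iff)

lemma sector_vector:
  assumes "0 < a * d - b * c"
  shows "sector (vector [a, b]) (vector [c, d]) =
    {x. 0 \<le> a * x$2 - b * x$1 \<and> 0 \<le> x$1 * d - x$2 * c}"
  using assms by (subst sector_eq_det2) (simp_all add: det2_def)

lemma lin2_vector: "lin2 p q r s (vector [a, b]) = vector [p * a + q * b, r * a + s * b]"
  by (simp add: lin2_def)

lemma uminus_vector2: "- vector [a, b] = (vector [- a, - b] :: real^2)"
  by (simp add: vec2_eq_iff)

lemma uminus_sector: "uminus ` sector u v = sector (- u) (- v)"
  by (rule linear_image_sector) (rule module_hom_uminus)

text \<open>The entries are 1 or -1, so this covers the reflections in the two coordinate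
  axes.\<close>

lemma orthogonal_lin2:
  assumes "p\<^sup>2 = 1" "s\<^sup>2 = 1"
  shows "orthogonal_transformation (lin2 p 0 0 s)"
proof -
  have "lin2 p 0 0 s v \<bullet> lin2 p 0 0 s w = p\<^sup>2 * (v$1 * w$1) + s\<^sup>2 * (v$2 * w$2)" for v w
    by (simp add: inner_vec_def sum_2 power2_eq_square)
  with assms show ?thesis
    unfolding orthogonal_transformation_def by (simp add: linear_lin2 inner_vec_def sum_2)
qed

text \<open>The update rule of \<open>\<sigma>1\<close>, read as a map of the whole real
  plane.\<close>

definition dynnikov_sigma1 :: "real^2 \<Rightarrow> real^2" where
  "dynnikov_sigma1 x = vector [x$1 + x$2 - Max {0, x$1, x$2}, max (x$2) 0 - x$1]"

definition dynnikov_sigma2 :: "real^2 \<Rightarrow> real^2" where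
  "dynnikov_sigma2 x = vector [max (x$1 + max 0 (x$2)) (x$2), x$2 - (x$1 + max 0 (x$2))]"

text \<open>The inverses are the conjugates of the update rules by the reflection that sends \<open>(a, b)\<close>
  to \<open>(-a, b)\<close>.\<close>

definition inv_dynnikov_sigma1 :: "real^2 \<Rightarrow> real^2" where
  "inv_dynnikov_sigma1 x = vector [x$1 - x$2 + Max {0, - x$1, x$2}, max (x$2) 0 + x$1]"

definition inv_dynnikov_sigma2 :: "real^2 \<Rightarrow> real^2" where
  "inv_dynnikov_sigma2 x = vector [- max (max 0 (x$2) - x$1) (x$2), x$2 + x$1 - max 0 (x$2)]"

lemmas dynnikov_sigma_defs =
  dynnikov_sigma1_def dynnikov_sigma2_def inv_dynnikov_sigma1_def inv_dynnikov_sigma2_def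

lemma dynnikov_sigma_inverse:
  "inv_dynnikov_sigma1 (dynnikov_sigma1 x) = x" "dynnikov_sigma1 (inv_dynnikov_sigma1 x) = x"
  "inv_dynnikov_sigma2 (dynnikov_sigma2 x) = x" "dynnikov_sigma2 (inv_dynnikov_sigma2 x) = x"
  by (auto simp: dynnikov_sigma_defs vec2_eq_iff max_def)

lemma dynnikov_sigma_0:
  "dynnikov_sigma1 0 = 0" "dynnikov_sigma2 0 = 0" "inv_dynnikov_sigma1 0 = 0" "inv_dynnikov_sigma2 0 = 0"
  by (auto simp: dynnikov_sigma_defs vec2_eq_iff)

lemma inv_dynnikov_sigma_int_plane:
  assumes "x \<in> int_plane"
  shows "inv_dynnikov_sigma1 x \<in> int_plane" "inv_dynnikov_sigma2 x \<in> int_plane"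
  using assms by (auto simp: dynnikov_sigma_defs int_plane_def max_def)

section \<open>Fans and matrices of the three twists\<close>

text \<open>The rays are those bounding the regions A, B, C, D, listed counterclockwise. For
  numerical rays the conditions of \<open>fan_regionsI\<close> are linear inequalities in the two
  coordinates.\<close>

lemma tc_fan:
  "fan_regions
     {sector (vector [0, -1]) (vector [1, 1]),
      sector (vector [1, 1]) (vector [1, 2]),
      sector (vector [1, 2]) (vector [-1, 0]),
      sector (vector [-1, 0]) (vector [0, -1])}"
  using fan_regionsI[of "[vector [0, -1], vector [1, 1], vector [1, 2], vector [-1, 0]]"]
  by - (simp add: det2_def, erule meta_mp, smt (verit))

lemma tc_image_fan:
  "fan_regions
     {sector (vector [-1, 1]) (vector [0, -1]),
      sector (vector [0, -1]) (vector [1, 0]),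
      sector (vector [1, 0]) (vector [-1, 2]),
      sector (vector [-1, 2]) (vector [-1, 1])}"
  using fan_regionsI[of "[vector [-1, 1], vector [0, -1], vector [1, 0], vector [-1, 2]]"]
  by - (simp add: det2_def, erule meta_mp, smt (verit))

text \<open>The isometry is the reflection that sends \<open>(a, b)\<close> to
  \<open>(-a, b)\<close>. It reverses orientation, whence \<open>sector_commute\<close>, and it
  matches the fans only as sets: it takes A to A' and C to C', but B to D' and D to B'.\<close>

lemma tc_similar_fans:
  "similar_fans
     {sector (vector [0, -1]) (vector [1, 1]),
      sector (vector [1, 1]) (vector [1, 2]),
      sector (vector [1, 2]) (vector [-1, 0]),
      sector (vector [-1, 0]) (vector [0, -1])}
     {sector (vector [-1, 1]) (vector [0, -1]),
      sector (vector [0, -1]) (vector [1, 0]),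
      sector (vector [1, 0]) (vector [-1, 2]),
      sector (vector [-1, 2]) (vector [-1, 1])}"
proof -
  have "orthogonal_transformation (lin2 (-1) 0 0 (1))"
    by (rule orthogonal_lin2) simp_all
  then show ?thesis
    unfolding similar_fans_def using tc_fan tc_image_fan
    by (intro conjI exI[of _ "lin2 (-1) 0 0 (1)"])
      (simp_all add: linear_image_sector linear_lin2 lin2_vector sector_commute insert_commute)
qed

lemma piecewise_linear_tc:
  assumes "\<And>x. x \<in> int_plane \<Longrightarrow> T x = dynnikov_sigma1 (dynnikov_sigma1 x)"
  shows "piecewise_linear_area_preserving T
     [(sector (vector [0, -1]) (vector [1, 1]), sector (vector [-1, 1]) (vector [0, -1])),
      (sector (vector [1, 1]) (vector [1, 2]), sector (vector [0, -1]) (vector [1, 0])),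
      (sector (vector [1, 2]) (vector [-1, 0]), sector (vector [1, 0]) (vector [-1, 2])),
      (sector (vector [-1, 0]) (vector [0, -1]), sector (vector [-1, 2]) (vector [-1, 1]))]"
proof -
  let ?F = "\<lambda>x. dynnikov_sigma1 (dynnikov_sigma1 x)"
  \<comment> \<open>The matrices are those of the square of the update rule on A, B, C and D, in
    this order.\<close>
  let ?qs = "[(vector [0, -1], vector [1, 1], -1, 1, 0, -1),
              (vector [1, 1], vector [1, 2], -1, 1, -2, 1),
              (vector [1, 2], vector [-1, 0], 1, 0, -2, 1),
              (vector [-1, 0], vector [0, -1], 1, 1, -2, -1)]
            :: ((real^2) \<times> (real^2) \<times> real \<times> real \<times> real \<times> real) list"
  let ?ps = "map (\<lambda>(u, v, p, q, r, s). (sector u v, sector (lin2 p q r s u) (lin2 p q r s v))) ?qs"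
  have "piecewise_linear_area_preserving T ?ps"
  proof (rule piecewise_linear_area_preservingI[of T ?F])
    show "inj ?F" by (rule injI) (metis dynnikov_sigma_inverse)
    show "\<forall>(u, v, _)\<in>set ?qs. 0 < det2 u v" by (simp add: det2_def)
    show "\<forall>(u, v, p, q, r, s)\<in>set ?qs. \<forall>x\<in>sector u v. ?F x = lin2 p q r s x"
      by (auto simp: sector_vector dynnikov_sigma_defs max_def vec2_eq_iff)
    show "similar_fans (fst ` set ?ps) (snd ` set ?ps)"
      using tc_similar_fans by (simp add: lin2_vector)
  qed (use assms in simp_all)
  then show ?thesis by (simp add: lin2_vector)
qed

lemma td_fan:
  "fan_regions
     {sector (vector [0, 1]) (vector [-1, -1]),
      sector (vector [-1, -1]) (vector [-1, -2]),
      sector (vector [-1, -2]) (vector [1, 0]),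
      sector (vector [1, 0]) (vector [0, 1])}"
  using fan_regionsI[of "[vector [0, 1], vector [-1, -1], vector [-1, -2], vector [1, 0]]"]
  by - (simp add: det2_def, erule meta_mp, smt (verit))

lemma td_image_fan:
  "fan_regions
     {sector (vector [1, -1]) (vector [0, 1]),
      sector (vector [0, 1]) (vector [-1, 0]),
      sector (vector [-1, 0]) (vector [1, -2]),
      sector (vector [1, -2]) (vector [1, -1])}"
  using fan_regionsI[of "[vector [1, -1], vector [0, 1], vector [-1, 0], vector [1, -2]]"]
  by - (simp add: det2_def, erule meta_mp, smt (verit))

lemma td_similar_fans:
  "similar_fans
     {sector (vector [0, 1]) (vector [-1, -1]),
      sector (vector [-1, -1]) (vector [-1, -2]),
      sector (vector [-1, -2]) (vector [1, 0]),
      sector (vector [1, 0]) (vector [0, 1])}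
     {sector (vector [1, -1]) (vector [0, 1]),
      sector (vector [0, 1]) (vector [-1, 0]),
      sector (vector [-1, 0]) (vector [1, -2]),
      sector (vector [1, -2]) (vector [1, -1])}"
proof -
  have "orthogonal_transformation (lin2 (-1) 0 0 (1))"
    by (rule orthogonal_lin2) simp_all
  then show ?thesis
    unfolding similar_fans_def using td_fan td_image_fan
    by (intro conjI exI[of _ "lin2 (-1) 0 0 (1)"])
      (simp_all add: linear_image_sector linear_lin2 lin2_vector sector_commute insert_commute)
qed

text \<open>The matrices are the same as for \<open>t_c\<close>, now on the opposite sectors: the
  two squares are conjugate by the point reflection in the origin.\<close>

lemma piecewise_linear_td:
  assumes "\<And>x. x \<in> int_plane \<Longrightarrow> T x = dynnikov_sigma2 (dynnikov_sigma2 x)"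
  shows "piecewise_linear_area_preserving T
     [(sector (vector [0, 1]) (vector [-1, -1]), sector (vector [1, -1]) (vector [0, 1])),
      (sector (vector [-1, -1]) (vector [-1, -2]), sector (vector [0, 1]) (vector [-1, 0])),
      (sector (vector [-1, -2]) (vector [1, 0]), sector (vector [-1, 0]) (vector [1, -2])),
      (sector (vector [1, 0]) (vector [0, 1]), sector (vector [1, -2]) (vector [1, -1]))]"
proof -
  let ?F = "\<lambda>x. dynnikov_sigma2 (dynnikov_sigma2 x)"
  let ?qs = "[(vector [0, 1], vector [-1, -1], -1, 1, 0, -1),
              (vector [-1, -1], vector [-1, -2], -1, 1, -2, 1),
              (vector [-1, -2], vector [1, 0], 1, 0, -2, 1),
              (vector [1, 0], vector [0, 1], 1, 1, -2, -1)]
            :: ((real^2) \<times> (real^2) \<times> real \<times> real \<times> real \<times> real) list"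
  let ?ps = "map (\<lambda>(u, v, p, q, r, s). (sector u v, sector (lin2 p q r s u) (lin2 p q r s v))) ?qs"
  have "piecewise_linear_area_preserving T ?ps"
  proof (rule piecewise_linear_area_preservingI[of T ?F])
    show "inj ?F" by (rule injI) (metis dynnikov_sigma_inverse)
    show "\<forall>(u, v, _)\<in>set ?qs. 0 < det2 u v" by (simp add: det2_def)
    show "\<forall>(u, v, p, q, r, s)\<in>set ?qs. \<forall>x\<in>sector u v. ?F x = lin2 p q r s x"
      by (auto simp: sector_vector dynnikov_sigma_defs max_def vec2_eq_iff)
    show "similar_fans (fst ` set ?ps) (snd ` set ?ps)"
      using td_similar_fans by (simp add: lin2_vector)
  qed (use assms in simp_all)
  then show ?thesis by (simp add: lin2_vector)
qed

text \<open>The cases are the image regions A', B', C', D' of \<open>t_c\<close> with the inverse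
  matrices. The explicit form leaves few cases when the two inverse squares are composed.\<close>

lemma inv_dynnikov_sigma1_twice:
  "inv_dynnikov_sigma1 (inv_dynnikov_sigma1 x) =
   (if x$1 \<le> 0 \<and> x$2 \<le> - x$1 then lin2 (-1) (-1) 0 (-1) x
    else if x$1 \<ge> 0 \<and> x$2 \<le> 0 then lin2 1 (-1) 2 (-1) x
    else if x$2 \<ge> 0 \<and> x$2 \<ge> - 2 * x$1 then lin2 1 0 2 1 x
    else lin2 (-1) (-1) 2 1 x)"
  by (auto simp: dynnikov_sigma_defs vec2_eq_iff max_def)

lemma inv_dynnikov_sigma2_twice:
  "inv_dynnikov_sigma2 (inv_dynnikov_sigma2 x) =
   (if x$1 \<ge> 0 \<and> x$2 \<ge> - x$1 then lin2 (-1) (-1) 0 (-1) x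
    else if x$1 \<le> 0 \<and> x$2 \<ge> 0 then lin2 1 (-1) 2 (-1) x
    else if x$2 \<le> 0 \<and> x$2 \<le> - 2 * x$1 then lin2 1 0 2 1 x
    else lin2 (-1) (-1) 2 1 x)"
  by (auto simp: dynnikov_sigma_defs vec2_eq_iff max_def)

text \<open>The inverse of \<open>t_c\<close> can break along (-1,1), (0,-1), (1,0), (-1,2). The
  break rays of the inverse of \<open>t_d\<close>, pulled back through it, add (-2,1), (0,1), (-3,2)
  and again (-1,2). Along (-1,2) the two changes of matrix cancel, which leaves six rays.\<close>

lemma te_fan:
  "fan_regions
     {sector (vector [1, 0]) (vector [0, 1]),
      sector (vector [0, 1]) (vector [-1, 1]),
      sector (vector [-1, 1]) (vector [-3, 2]),
      sector (vector [-3, 2]) (vector [-2, 1]),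
      sector (vector [-2, 1]) (vector [0, -1]),
      sector (vector [0, -1]) (vector [1, 0])}"
  using fan_regionsI[of "[vector [1, 0], vector [0, 1], vector [-1, 1], vector [-3, 2],
      vector [-2, 1], vector [0, -1]]"]
  by - (simp add: det2_def, erule meta_mp, smt (verit))

lemma te_image_fan:
  "fan_regions
     {sector (vector [-3, -2]) (vector [-1, -1]),
      sector (vector [-1, -1]) (vector [0, -1]),
      sector (vector [0, -1]) (vector [1, 0]),
      sector (vector [1, 0]) (vector [0, 1]),
      sector (vector [0, 1]) (vector [-2, -1]),
      sector (vector [-2, -1]) (vector [-3, -2])}"
  using fan_regionsI[of "[vector [-3, -2], vector [-1, -1], vector [0, -1], vector [1, 0],
      vector [0, 1], vector [-2, -1]]"]
  by - (simp add: det2_def, erule meta_mp, smt (verit))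

text \<open>Here the isometry is the reflection that sends \<open>(a, b)\<close> to
  \<open>(a, -b)\<close>.\<close>

lemma te_similar_fans:
  "similar_fans
     {sector (vector [1, 0]) (vector [0, 1]),
      sector (vector [0, 1]) (vector [-1, 1]),
      sector (vector [-1, 1]) (vector [-3, 2]),
      sector (vector [-3, 2]) (vector [-2, 1]),
      sector (vector [-2, 1]) (vector [0, -1]),
      sector (vector [0, -1]) (vector [1, 0])}
     {sector (vector [-3, -2]) (vector [-1, -1]),
      sector (vector [-1, -1]) (vector [0, -1]),
      sector (vector [0, -1]) (vector [1, 0]),
      sector (vector [1, 0]) (vector [0, 1]),
      sector (vector [0, 1]) (vector [-2, -1]),
      sector (vector [-2, -1]) (vector [-3, -2])}"
proof -
  have "orthogonal_transformation (lin2 (1) 0 0 (-1))"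
    by (rule orthogonal_lin2) simp_all
  then show ?thesis
    unfolding similar_fans_def using te_fan te_image_fan
    by (intro conjI exI[of _ "lin2 (1) 0 0 (-1)"])
      (simp_all add: linear_image_sector linear_lin2 lin2_vector sector_commute insert_commute)
qed

lemma piecewise_linear_te:
  assumes "\<And>x. x \<in> int_plane \<Longrightarrow>
    T x = inv_dynnikov_sigma2 (inv_dynnikov_sigma2 (inv_dynnikov_sigma1 (inv_dynnikov_sigma1 x)))"
  shows "piecewise_linear_area_preserving T
     [(sector (vector [1, 0]) (vector [0, 1]), sector (vector [-3, -2]) (vector [-1, -1])),
      (sector (vector [0, -1]) (vector [1, 0]), sector (vector [-2, -1]) (vector [-3, -2])),
      (sector (vector [-2, 1]) (vector [0, -1]), sector (vector [0, 1]) (vector [-2, -1])),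
      (sector (vector [-3, 2]) (vector [-2, 1]), sector (vector [1, 0]) (vector [0, 1])),
      (sector (vector [-1, 1]) (vector [-3, 2]), sector (vector [0, -1]) (vector [1, 0])),
      (sector (vector [0, 1]) (vector [-1, 1]), sector (vector [-1, -1]) (vector [0, -1]))]"
proof -
  let ?F = "\<lambda>x. inv_dynnikov_sigma2 (inv_dynnikov_sigma2 (inv_dynnikov_sigma1 (inv_dynnikov_sigma1 x)))"
  let ?qs = "[(vector [1, 0], vector [0, 1], -3, -1, -2, -1),
              (vector [0, -1], vector [1, 0], -3, 2, -2, 1),
              (vector [-2, 1], vector [0, -1], 1, 2, 0, 1),
              (vector [-3, 2], vector [-2, 1], 1, 2, -2, -3),
              (vector [-1, 1], vector [-3, 2], -1, -1, -2, -3),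
              (vector [0, 1], vector [-1, 1], -1, -1, 0, -1)]
            :: ((real^2) \<times> (real^2) \<times> real \<times> real \<times> real \<times> real) list"
  let ?ps = "map (\<lambda>(u, v, p, q, r, s). (sector u v, sector (lin2 p q r s u) (lin2 p q r s v))) ?qs"
  have "piecewise_linear_area_preserving T ?ps"
  proof (rule piecewise_linear_area_preservingI[of T ?F])
    show "inj ?F" by (rule injI) (metis dynnikov_sigma_inverse)
    show "\<forall>(u, v, _)\<in>set ?qs. 0 < det2 u v" by (simp add: det2_def)
    show "\<forall>(u, v, p, q, r, s)\<in>set ?qs. \<forall>x\<in>sector u v. ?F x = lin2 p q r s x"
      by (auto simp: sector_vector inv_dynnikov_sigma1_twice inv_dynnikov_sigma2_twice vec2_eq_iff)
    show "similar_fans (fst ` set ?ps) (snd ` set ?ps)"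
      using te_similar_fans by (simp add: lin2_vector insert_commute)
  qed (use assms in simp_all)
  then show ?thesis by (simp add: lin2_vector)
qed

section \<open>Transfer to the coordinate plane\<close>

text \<open>Away from the origin every lattice point is the coordinate vector of a curve system; at
  the origin \<open>f 0 = 0\<close> matches the convention in
  \<open>dynnikov_action\<close>.\<close>

lemma dynnikov_action_eq:
  assumes "bij_betw dynnikov curve_systems (int_plane - {0})"
    and "\<And>L. L \<in> curve_systems \<Longrightarrow> dynnikov (act \<phi> L) = f (dynnikov L)"
    and "f 0 = 0" "x \<in> int_plane"
  shows "dynnikov_action \<phi> x = f x"
  using assms bij_betwE[OF bij_betw_inv_into[OF assms(1)]] bij_betw_inv_into_right[OF assms(1)]
  by (simp add: dynnikov_action_def)

text \<open>The rule applies a second time because \<open>act \<phi> L\<close> is again a curve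
  system.\<close>

lemma dynnikov_act_half_twist_squared:
  assumes "\<phi> \<in> Mod" "mcg_mult \<phi> \<phi> \<noteq> {}" "L \<in> curve_systems"
    and f: "\<And>L. L \<in> curve_systems \<Longrightarrow> dynnikov (act \<phi> L) = f (dynnikov L)"
  shows "dynnikov (act (mcg_mult \<phi> \<phi>) L) = f (f (dynnikov L))"
  using assms act_in_curve_systems[of \<phi> L] mcg_mult_emptyD[of \<phi> \<phi>]
  by (simp add: act_mcg_mult)

theorem theorem1p1:
  fixes \<sigma>1 \<sigma>2 tc td te :: mapping_class
    and A B C D A' B' C' D' :: "(real^2) set"
  assumes dynnikov_bij: "bij_betw dynnikov curve_systems (int_plane - {0})"
    and sigma1: "half_twist (-1/2) \<sigma>1"
    and sigma2: "half_twist (1/2) \<sigma>2"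
    and update1: "\<And>l a b. l \<in> curve_systems \<Longrightarrow> dynnikov l = vector [a, b] \<Longrightarrow>
        dynnikov (act \<sigma>1 l) = vector [a + b - Max {0, a, b}, max b 0 - a]"
    and update2: "\<And>l a b. l \<in> curve_systems \<Longrightarrow> dynnikov l = vector [a, b] \<Longrightarrow>
        dynnikov (act \<sigma>2 l) = vector [max (a + max 0 b) b, b - (a + max 0 b)]"
    and tc: "dehn_twist curve_c tc" "tc = mcg_mult \<sigma>1 \<sigma>1"
    and td: "dehn_twist curve_d td" "td = mcg_mult \<sigma>2 \<sigma>2"
    and te: "dehn_twist curve_e te"
        "\<And>l. l \<in> curve_systems \<Longrightarrow> act te (act (mcg_mult tc td) l) = l"
    and A: "A = {x. x$1 \<ge> 0 \<and> x$2 \<le> x$1}"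
    and B: "B = {x. 0 \<le> x$1 \<and> x$1 \<le> x$2 \<and> x$2 \<le> 2 * x$1}"
    and C: "C = {x. 2 * x$1 \<le> x$2 \<and> x$2 \<ge> 0}"
    and D: "D = {x. x$1 \<le> 0 \<and> x$2 \<le> 0}"
    and A': "A' = {x. x$1 \<le> 0 \<and> x$2 \<le> - x$1}"
    and B': "B' = {x. x$1 \<ge> 0 \<and> x$2 \<le> 0}"
    and C': "C' = {x. x$2 \<ge> 0 \<and> x$2 \<ge> - 2 * x$1}"
    and D': "D' = {x. 0 \<le> - x$1 \<and> - x$1 \<le> x$2 \<and> x$2 \<le> - 2 * x$1}"
  shows "piecewise_linear_area_preserving (dynnikov_action tc) [(A, A'), (B, B'), (C, C'), (D, D')]
    \<and> piecewise_linear_area_preserving (dynnikov_action td)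
        [(uminus ` A, uminus ` A'), (uminus ` B, uminus ` B'),
         (uminus ` C, uminus ` C'), (uminus ` D, uminus ` D')]
    \<and> uminus ` A = {x. x$1 \<le> 0 \<and> x$1 \<le> x$2}
    \<and> uminus ` B = {x. 2 * x$1 \<le> x$2 \<and> x$2 \<le> x$1 \<and> x$1 \<le> 0}
    \<and> uminus ` C = {x. x$2 \<le> 2 * x$1 \<and> x$2 \<le> 0}
    \<and> uminus ` D = {x. x$1 \<ge> 0 \<and> x$2 \<ge> 0}
    \<and> piecewise_linear_area_preserving (dynnikov_action te)
        [({x. x$1 \<ge> 0 \<and> x$2 \<ge> 0},
          {x. 3 * x$2 / 2 \<le> x$1 \<and> x$1 \<le> x$2 \<and> x$2 \<le> 0}),
         ({x. x$1 \<ge> 0 \<and> x$2 \<le> 0},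
          {x. 2 * x$2 \<le> x$1 \<and> x$1 \<le> 3 * x$2 / 2 \<and> 3 * x$2 / 2 \<le> 0}),
         ({x. x$1 \<le> 0 \<and> x$2 \<le> - x$1 / 2},
          {x. x$1 \<le> 0 \<and> x$1 / 2 \<le> x$2}),
         ({x. 0 \<le> - x$1 / 2 \<and> - x$1 / 2 \<le> x$2 \<and> x$2 \<le> - 2 * x$1 / 3},
          {x. x$1 \<ge> 0 \<and> x$2 \<ge> 0}),
         ({x. 0 \<le> - 2 * x$1 / 3 \<and> - 2 * x$1 / 3 \<le> x$2 \<and> x$2 \<le> - x$1},
          {x. x$1 \<ge> 0 \<and> x$2 \<le> 0}),
         ({x. 0 \<le> - x$1 \<and> - x$1 \<le> x$2},
          {x. x$2 \<le> x$1 \<and> x$1 \<le> 0})]"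
proof (intro conjI)
  \<comment> \<open>The classes \<open>tc\<close> and \<open>td\<close> are nonempty because a Dehn
    twist exhibits a representative.\<close>
  have Mod: "\<sigma>1 \<in> Mod" "\<sigma>2 \<in> Mod" "tc \<in> Mod" "td \<in> Mod" "tc \<noteq> {}" "td \<noteq> {}"
    using sigma1 sigma2 tc(1) td(1) unfolding half_twist_def dehn_twist_def by blast+
  have s1: "dynnikov (act \<sigma>1 L) = dynnikov_sigma1 (dynnikov L)" if "L \<in> curve_systems" for L
    using update1[OF that vector_eta2[symmetric]] by (simp add: dynnikov_sigma1_def)
  have s2: "dynnikov (act \<sigma>2 L) = dynnikov_sigma2 (dynnikov L)" if "L \<in> curve_systems" for L
    using update2[OF that vector_eta2[symmetric]] by (simp add: dynnikov_sigma2_def)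
  have c: "dynnikov (act tc L) = dynnikov_sigma1 (dynnikov_sigma1 (dynnikov L))"
    if "L \<in> curve_systems" for L
    using dynnikov_act_half_twist_squared[OF Mod(1) _ that s1] Mod(5) tc(2) by simp
  have d: "dynnikov (act td L) = dynnikov_sigma2 (dynnikov_sigma2 (dynnikov L))"
    if "L \<in> curve_systems" for L
    using dynnikov_act_half_twist_squared[OF Mod(2) _ that s2] Mod(6) td(2) by simp
  let ?G = "\<lambda>x. inv_dynnikov_sigma2 (inv_dynnikov_sigma2 (inv_dynnikov_sigma1 (inv_dynnikov_sigma1 x)))"
  \<comment> \<open>The action of \<open>te\<close> is prescribed only on systems of the form
    \<open>t_c t_d L\<close>. Taking for \<open>L\<close> the system with coordinates
    \<open>?G (dynnikov M)\<close> makes \<open>t_c t_d L\<close> have the coordinates of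
    \<open>M\<close>, hence equal \<open>M\<close>, so \<open>te\<close> sends \<open>M\<close> to
    \<open>L\<close>.\<close>
  have e: "dynnikov (act te M) = ?G (dynnikov M)" if M: "M \<in> curve_systems" for M
  proof -
    \<comment> \<open>An empty product would make \<open>te\<close> send everything to the empty
      set, contrary to its inverting the action on the nonempty \<open>M\<close>.\<close>
    have "act te (act {} M) = {}" by (simp add: act_def)
    then have ne: "mcg_mult tc td \<noteq> {}"
      using te(2)[OF M] curve_systems_nonempty[OF M] by metis
    have y: "dynnikov M \<in> int_plane" "dynnikov M \<noteq> 0"
      using bij_betwE[OF dynnikov_bij] M by auto
    \<comment> \<open>\<open>?G\<close> is invertible and fixes the origin; as it also preserves the
      lattice, its value here lies in the range of \<open>dynnikov\<close>.\<close>
    have "?G (dynnikov M) \<noteq> 0"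
      using y(2) dynnikov_sigma_inverse dynnikov_sigma_0 by metis
    moreover have "?G (dynnikov M) \<in> int_plane"
      using y(1) inv_dynnikov_sigma_int_plane by simp
    ultimately obtain L where L: "L \<in> curve_systems" "dynnikov L = ?G (dynnikov M)"
      using dynnikov_bij unfolding bij_betw_def by (metis DiffI imageE singletonD)
    have dL: "act td L \<in> curve_systems" using act_in_curve_systems[OF Mod(4,6) L(1)] .
    have "dynnikov (act tc (act td L)) = dynnikov M"
      using c[OF dL] d[OF L(1)] L(2) dynnikov_sigma_inverse by simp
    then have "act tc (act td L) = M"
      using dynnikov_bij M act_in_curve_systems[OF Mod(3,5) dL] by (auto simp: bij_betw_def dest: inj_onD)
    then have "act te M = L"
      using te(2)[OF L(1)] act_mcg_mult[OF Mod(3,4) ne L(1)] by simp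
    then show ?thesis using L(2) by simp
  qed
  note eq = dynnikov_action_eq[OF dynnikov_bij]
  have "dynnikov_action tc x = dynnikov_sigma1 (dynnikov_sigma1 x)" if "x \<in> int_plane" for x
    by (rule eq[OF c _ that]) (simp_all add: dynnikov_sigma_0)
  note tc_linear = piecewise_linear_tc[OF this]
  have "dynnikov_action td x = dynnikov_sigma2 (dynnikov_sigma2 x)" if "x \<in> int_plane" for x
    by (rule eq[OF d _ that]) (simp_all add: dynnikov_sigma_0)
  note td_linear = piecewise_linear_td[OF this]
  have "dynnikov_action te x = ?G x" if "x \<in> int_plane" for x
    by (rule eq[OF e _ that]) (simp_all add: dynnikov_sigma_0)
  note te_linear = piecewise_linear_te[OF this]
  have sectors:
    "A = sector (vector [0, -1]) (vector [1, 1])" "A' = sector (vector [-1, 1]) (vector [0, -1])"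
    "B = sector (vector [1, 1]) (vector [1, 2])" "B' = sector (vector [0, -1]) (vector [1, 0])"
    "C = sector (vector [1, 2]) (vector [-1, 0])" "C' = sector (vector [1, 0]) (vector [-1, 2])"
    "D = sector (vector [-1, 0]) (vector [0, -1])" "D' = sector (vector [-1, 2]) (vector [-1, 1])"
    unfolding A A' B B' C C' D D' by (auto simp: sector_vector)
  show "piecewise_linear_area_preserving (dynnikov_action tc) [(A, A'), (B, B'), (C, C'), (D, D')]"
    unfolding sectors by (rule tc_linear)
  show "piecewise_linear_area_preserving (dynnikov_action td)
        [(uminus ` A, uminus ` A'), (uminus ` B, uminus ` B'),
         (uminus ` C, uminus ` C'), (uminus ` D, uminus ` D')]"
    unfolding sectors uminus_sector uminus_vector2 using td_linear by simp
  show "uminus ` A = {x. x$1 \<le> 0 \<and> x$1 \<le> x$2}"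
    "uminus ` B = {x. 2 * x$1 \<le> x$2 \<and> x$2 \<le> x$1 \<and> x$1 \<le> 0}"
    "uminus ` C = {x. x$2 \<le> 2 * x$1 \<and> x$2 \<le> 0}"
    "uminus ` D = {x. x$1 \<ge> 0 \<and> x$2 \<ge> 0}"
    unfolding sectors uminus_sector uminus_vector2 by (auto simp: sector_vector)
  show "piecewise_linear_area_preserving (dynnikov_action te)
        [({x. x$1 \<ge> 0 \<and> x$2 \<ge> 0},
          {x. 3 * x$2 / 2 \<le> x$1 \<and> x$1 \<le> x$2 \<and> x$2 \<le> 0}),
         ({x. x$1 \<ge> 0 \<and> x$2 \<le> 0},
          {x. 2 * x$2 \<le> x$1 \<and> x$1 \<le> 3 * x$2 / 2 \<and> 3 * x$2 / 2 \<le> 0}),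
         ({x. x$1 \<le> 0 \<and> x$2 \<le> - x$1 / 2},
          {x. x$1 \<le> 0 \<and> x$1 / 2 \<le> x$2}),
         ({x. 0 \<le> - x$1 / 2 \<and> - x$1 / 2 \<le> x$2 \<and> x$2 \<le> - 2 * x$1 / 3},
          {x. x$1 \<ge> 0 \<and> x$2 \<ge> 0}),
         ({x. 0 \<le> - 2 * x$1 / 3 \<and> - 2 * x$1 / 3 \<le> x$2 \<and> x$2 \<le> - x$1},
          {x. x$1 \<ge> 0 \<and> x$2 \<le> 0}),
         ({x. 0 \<le> - x$1 \<and> - x$1 \<le> x$2},
          {x. x$2 \<le> x$1 \<and> x$1 \<le> 0})]"
    (is "?te [(?R1, ?R1'), (?R2, ?R2'), (?R3, ?R3'), (?R4, ?R4'), (?R5, ?R5'), (?R6, ?R6')]")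
  proof -
    have regions:
      "?R1 = sector (vector [1, 0]) (vector [0, 1])" "?R1' = sector (vector [-3, -2]) (vector [-1, -1])"
      "?R2 = sector (vector [0, -1]) (vector [1, 0])" "?R2' = sector (vector [-2, -1]) (vector [-3, -2])"
      "?R3 = sector (vector [-2, 1]) (vector [0, -1])" "?R3' = sector (vector [0, 1]) (vector [-2, -1])"
      "?R4 = sector (vector [-3, 2]) (vector [-2, 1])" "?R4' = sector (vector [1, 0]) (vector [0, 1])"
      "?R5 = sector (vector [-1, 1]) (vector [-3, 2])" "?R5' = sector (vector [0, -1]) (vector [1, 0])"
      "?R6 = sector (vector [0, 1]) (vector [-1, 1])" "?R6' = sector (vector [-1, -1]) (vector [0, -1])"
      by (auto simp: sector_vector)
    show ?thesis
      unfolding regions by (rule te_linear)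
  qed
qed

end
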